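(* Let $\alpha,\beta$ be real numbers with $\alpha>2$ and $\beta>2$. Let $E$ be the lowest eigenvalue of the self-adjoint operator $Q(\alpha,\beta)$ on $\mathbb{C}^2\otimes L^2(\mathbb{R})$, and let $\mathscr{G}=\operatorname{Ker}(Q(\alpha,\beta)-E)$. Then $\dim\mathscr{G}\le 2$ and $\mathscr{G}\subset\mathbb{C}^2\otimes L_+$, where $L_+\subset L^2(\mathbb{R})$ is the subspace of even functions. That is, the multiplicity of $E$ is at most two and all ground states are even functions.
   Context: For $\alpha,\beta>0$ with $\alpha\beta>1$, the non-commutative harmonic oscillator is the operator $$Q(\alpha,\beta)=A\otimes\left(-\frac12\frac{d^2}{dx^2}+\frac12x^2\right)+J\otimes\left(x\frac{d}{dx}+\frac12\right),\quad A=\begin{pmatrix}\alpha&0\\0&\beta\end{pmatrix},\quad J=\begin{pmatrix}0&-1\\1&0\end{pmatrix},$$ acting in the Hilbert space $\mathbb{C}^2\otimes L^2(\mathbb{R})$. It defines a positive self-adjoint operator with purely discrete spectrum $\lambda_1\le\lambda_2\le\cdots\uparrow\infty$ (eigenvalues counted with multiplicity). $E=\lambda_1$ is the lowest eigenvalue, and eigenvectors associated with $E$ are called ground states. *)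

theory Defs
  imports "HOL-Analysis.Analysis"
begin

text \<open>The Hilbert space \<open>L\<^sup>2(\<real>)\<close> of complex-valued functions modulo equality almost everywhere.\<close>

definition square_integrable :: "(real \<Rightarrow> complex) \<Rightarrow> bool" where
  "square_integrable f \<longleftrightarrow>
     f \<in> borel_measurable lborel \<and> integrable lborel (\<lambda>x. (norm (f x))\<^sup>2)"

definition L2_rel :: "(real \<Rightarrow> complex) \<Rightarrow> (real \<Rightarrow> complex) \<Rightarrow> bool" where
  "L2_rel f g \<longleftrightarrow>
     square_integrable f \<and> square_integrable g \<and> (AE x in lborel. f x = g x)"

lemma square_integrable_zero: "square_integrable (\<lambda>x. 0)"
  by (simp add: square_integrable_def)

quotient_type L2 = "real \<Rightarrow> complex" / partial: L2_rel
proof (rule part_equivpI)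
  show "\<exists>f. L2_rel f f"
    using square_integrable_zero by (auto simp: L2_rel_def)
  show "symp L2_rel"
    by (auto simp: L2_rel_def symp_def elim: eventually_mono)
  show "transp L2_rel"
    by (auto simp: L2_rel_def transp_def elim: eventually_elim2)
qed

lemma square_integrable_cmult:
  assumes "square_integrable f"
  shows "square_integrable (\<lambda>x. c * f x)"
  using assms by (auto simp: square_integrable_def norm_mult power_mult_distrib)

lemma square_integrable_scaleR:
  assumes "square_integrable f"
  shows "square_integrable (\<lambda>x. r *\<^sub>R f x)"
  using square_integrable_cmult[OF assms, of "of_real r"] by (simp add: scaleR_conv_of_real)

lemma square_integrable_uminus:
  assumes "square_integrable f"
  shows "square_integrable (\<lambda>x. - f x)"
  using square_integrable_cmult[OF assms, of "-1"] by simp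

lemma square_integrable_add:
  assumes "square_integrable f" "square_integrable g"
  shows "square_integrable (\<lambda>x. f x + g x)"
proof -
  have [measurable]: "f \<in> borel_measurable lborel" "g \<in> borel_measurable lborel"
    using assms by (auto simp: square_integrable_def)
  have "integrable lborel (\<lambda>x. 2 * (norm (f x))\<^sup>2 + 2 * (norm (g x))\<^sup>2)"
    using assms by (auto simp: square_integrable_def)
  moreover have "(norm (f x + g x))\<^sup>2 \<le> 2 * (norm (f x))\<^sup>2 + 2 * (norm (g x))\<^sup>2" for x
  proof -
    have "(norm (f x + g x))\<^sup>2 \<le> (norm (f x) + norm (g x))\<^sup>2"
      by (intro power_mono norm_triangle_ineq) auto
    also have "\<dots> \<le> 2 * (norm (f x))\<^sup>2 + 2 * (norm (g x))\<^sup>2"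
      using zero_le_power2[of "norm (f x) - norm (g x)"]
      by (simp add: power2_eq_square algebra_simps)
    finally show ?thesis .
  qed
  ultimately have "integrable lborel (\<lambda>x. (norm (f x + g x))\<^sup>2)"
    by (elim Bochner_Integration.integrable_bound) auto
  then show ?thesis by (auto simp: square_integrable_def)
qed

lemma square_integrable_diff:
  assumes "square_integrable f" "square_integrable g"
  shows "square_integrable (\<lambda>x. f x - g x)"
  using square_integrable_add[OF assms(1) square_integrable_uminus[OF assms(2)]] by simp

lemma integrable_inner_square_integrable:
  assumes "square_integrable f" "square_integrable g"
  shows "integrable lborel (\<lambda>x. f x \<bullet> g x)"
proof -
  have [measurable]: "f \<in> borel_measurable lborel" "g \<in> borel_measurable lborel"
    using assms by (auto simp: square_integrable_def)
  have "integrable lborel (\<lambda>x. (norm (f x))\<^sup>2 + (norm (g x))\<^sup>2)"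
    using assms by (auto simp: square_integrable_def)
  moreover have "\<bar>f x \<bullet> g x\<bar> \<le> (norm (f x))\<^sup>2 + (norm (g x))\<^sup>2" for x
  proof -
    have "\<bar>f x \<bullet> g x\<bar> \<le> norm (f x) * norm (g x)"
      by (rule Cauchy_Schwarz_ineq2)
    also have "\<dots> \<le> (norm (f x))\<^sup>2 + (norm (g x))\<^sup>2"
      using zero_le_power2[of "norm (f x) - norm (g x)"]
        mult_nonneg_nonneg[OF norm_ge_zero norm_ge_zero, of "f x" "g x"]
      unfolding power2_diff by linarith
    finally show ?thesis .
  qed
  ultimately show ?thesis
    by (elim Bochner_Integration.integrable_bound) auto
qed

instantiation L2 :: real_inner
begin

lift_definition zero_L2 :: L2 is "\<lambda>x. 0"
  by (simp add: L2_rel_def square_integrable_zero)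

lift_definition plus_L2 :: "L2 \<Rightarrow> L2 \<Rightarrow> L2" is "\<lambda>f g x. f x + g x"
  by (auto simp: L2_rel_def square_integrable_add elim: eventually_elim2)

lift_definition minus_L2 :: "L2 \<Rightarrow> L2 \<Rightarrow> L2" is "\<lambda>f g x. f x - g x"
  by (auto simp: L2_rel_def square_integrable_diff elim: eventually_elim2)

lift_definition uminus_L2 :: "L2 \<Rightarrow> L2" is "\<lambda>f x. - f x"
  by (auto simp: L2_rel_def square_integrable_uminus elim: eventually_mono)

lift_definition scaleR_L2 :: "real \<Rightarrow> L2 \<Rightarrow> L2" is "\<lambda>r f x. r *\<^sub>R f x"
  by (auto simp: L2_rel_def square_integrable_scaleR simp del: complex_scaleR
      elim: eventually_mono)

text \<open>Since \<open>z \<bullet> w = Re (cnj z * w)\<close> on \<open>\<complex>\<close>, this is the real part of the usual Hermitian inner product;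
  it induces the usual norm.\<close>

lift_definition inner_L2 :: "L2 \<Rightarrow> L2 \<Rightarrow> real" is "\<lambda>f g. LINT x|lborel. f x \<bullet> g x"
  unfolding L2_rel_def
  by (intro integral_cong_AE)
    (auto simp: square_integrable_def elim: eventually_elim2)

definition norm_L2 :: "L2 \<Rightarrow> real" where
  "norm_L2 u = sqrt (u \<bullet> u)"

definition sgn_L2 :: "L2 \<Rightarrow> L2" where
  "sgn_L2 u = inverse (norm u) *\<^sub>R u"

definition dist_L2 :: "L2 \<Rightarrow> L2 \<Rightarrow> real" where
  "dist_L2 u v = norm (u - v)"

definition uniformity_L2 :: "(L2 \<times> L2) filter" where
  "uniformity_L2 = (INF e\<in>{0<..}. principal {(u, v). dist u v < e})"

definition open_L2 :: "L2 set \<Rightarrow> bool" where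
  "open_L2 U \<longleftrightarrow> (\<forall>u\<in>U. \<forall>\<^sub>F (u', v) in uniformity. u' = u \<longrightarrow> v \<in> U)"

instance
proof
  fix u v w :: L2 and r s :: real and U :: "L2 set"
  show "u + v + w = u + (v + w)"
    by transfer (auto simp: L2_rel_def add.assoc square_integrable_add)
  show "u + v = v + u"
    by transfer (auto simp: L2_rel_def add.commute square_integrable_add)
  show "0 + u = u"
    by transfer (auto simp: L2_rel_def)
  show "- u + u = 0"
    by transfer (auto simp: L2_rel_def square_integrable_zero)
  show "u - v = u + - v"
    by transfer (auto simp: L2_rel_def square_integrable_diff)
  show "r *\<^sub>R (u + v) = r *\<^sub>R u + r *\<^sub>R v"
    by transfer (auto simp: L2_rel_def scaleR_add_right square_integrable_add
        square_integrable_scaleR simp del: complex_scaleR)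
  show "(r + s) *\<^sub>R u = r *\<^sub>R u + s *\<^sub>R u"
    by transfer (auto simp: L2_rel_def scaleR_add_left square_integrable_add
        square_integrable_scaleR simp del: complex_scaleR)
  show "r *\<^sub>R s *\<^sub>R u = (r * s) *\<^sub>R u"
    by transfer (auto simp: L2_rel_def square_integrable_scaleR simp del: complex_scaleR)
  show "1 *\<^sub>R u = u"
    by transfer (auto simp: L2_rel_def)
  show "dist u v = norm (u - v)"
    by (rule dist_L2_def)
  show "sgn u = inverse (norm u) *\<^sub>R u"
    by (rule sgn_L2_def)
  show "uniformity = (INF e\<in>{0<..}. principal {(u::L2, v). dist u v < e})"
    by (rule uniformity_L2_def)
  show "open U \<longleftrightarrow> (\<forall>u\<in>U. \<forall>\<^sub>F (u', v) in uniformity. u' = u \<longrightarrow> v \<in> U)"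
    by (rule open_L2_def)
  show "norm u = sqrt (u \<bullet> u)"
    by (rule norm_L2_def)
  show "u \<bullet> v = v \<bullet> u"
    by transfer (simp add: inner_commute)
  show "(u + v) \<bullet> w = u \<bullet> w + v \<bullet> w"
    by transfer (simp add: L2_rel_def inner_add_left integrable_inner_square_integrable)
  show "(r *\<^sub>R u) \<bullet> v = r * (u \<bullet> v)"
    by transfer (simp add: L2_rel_def integrable_inner_square_integrable)
  show "0 \<le> u \<bullet> u"
    by transfer simp
  show "u \<bullet> u = 0 \<longleftrightarrow> u = 0"
  proof transfer
    fix f :: "real \<Rightarrow> complex" assume "L2_rel f f"
    then have f: "square_integrable f" by (simp add: L2_rel_def)
    have "(LINT x|lborel. f x \<bullet> f x) = 0 \<longleftrightarrow> (AE x in lborel. f x \<bullet> f x = 0)"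
      by (intro integral_nonneg_eq_0_iff_AE integrable_inner_square_integrable f) auto
    then show "(LINT x|lborel. f x \<bullet> f x) = 0 \<longleftrightarrow> L2_rel f (\<lambda>x. 0)"
      using f by (simp add: L2_rel_def square_integrable_zero)
  qed
qed

end

lift_definition scaleC_L2 :: "complex \<Rightarrow> L2 \<Rightarrow> L2" is "\<lambda>c f x. c * f x"
  by (auto simp: L2_rel_def square_integrable_cmult elim: eventually_mono)

text \<open>\<open>\<complex>\<^sup>2 \<otimes> L\<^sup>2(\<real>)\<close> is rendered as \<open>L2 ^ 2\<close>, whose library norm is the
  Hilbert direct sum norm. The linear algebra below is over \<open>\<complex>\<close>. As always for
  \<open>vector_space.dim\<close>, \<open>cdim\<close> is \<open>0\<close> on infinite-dimensional spaces, so bounds on it have to be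
  accompanied by finite-dimensionality.\<close>

definition scaleC_vec :: "complex \<Rightarrow> L2 ^ 2 \<Rightarrow> L2 ^ 2" where
  "scaleC_vec c u = (\<chi> i. scaleC_L2 c (u $ i))"

global_interpretation CL2: vector_space scaleC_vec
  defines cspan = CL2.span
    and csubspace = CL2.subspace
    and cdependent = CL2.dependent
    and cdim = CL2.dim
proof
  have *: "scaleC_L2 c (u + v) = scaleC_L2 c u + scaleC_L2 c v"
    "scaleC_L2 (c + d) u = scaleC_L2 c u + scaleC_L2 d u"
    "scaleC_L2 c (scaleC_L2 d u) = scaleC_L2 (c * d) u"
    "scaleC_L2 1 u = u" for c d u v
    by (transfer; auto simp: L2_rel_def algebra_simps square_integrable_add
        square_integrable_cmult)+
  fix c d and u v :: "L2 ^ 2"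
  show "scaleC_vec c (u + v) = scaleC_vec c u + scaleC_vec c v"
    "scaleC_vec (c + d) u = scaleC_vec c u + scaleC_vec d u"
    "scaleC_vec c (scaleC_vec d u) = scaleC_vec (c * d) u"
    "scaleC_vec 1 u = u"
    by (simp_all add: scaleC_vec_def vec_eq_iff *)
qed

lift_definition even_L2 :: "L2 \<Rightarrow> bool" is "\<lambda>f. AE x in lborel. f (- x) = f x"
proof -
  have *: "AE x in lborel. g (- x) = g x"
    if "L2_rel f g" and f: "AE x in lborel. f (- x) = f x" for f g
  proof -
    have [measurable]: "f \<in> borel_measurable borel" "g \<in> borel_measurable borel"
      and fg: "AE x in lborel. f x = g x"
      using that(1) by (auto simp: L2_rel_def square_integrable_def)
    have "AE x in distr lborel borel uminus. f x = g x"
      using fg unfolding lborel_distr_uminus .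
    then have "AE x in lborel. f (- x) = g (- x)"
      by (subst (asm) AE_distr_iff) auto
    with f fg show ?thesis by eventually_elim simp
  qed
  fix f g assume "L2_rel f g"
  moreover from this have "L2_rel g f"
    by (auto simp: L2_rel_def elim: eventually_mono)
  ultimately show "(AE x in lborel. f (- x) = f x) = (AE x in lborel. g (- x) = g x)"
    using * by blast
qed

definition L_plus :: "L2 set" where
  "L_plus = {f. even_L2 f}"

definition vderiv :: "(real \<Rightarrow> complex) \<Rightarrow> real \<Rightarrow> complex" where
  "vderiv f = (\<lambda>x. vector_derivative f (at x))"

definition schwartz :: "(real \<Rightarrow> complex) \<Rightarrow> bool" where
  "schwartz f \<longleftrightarrow>
     (\<forall>n x. (vderiv ^^ n) f differentiable (at x)) \<and>
     (\<forall>m n. bounded (range (\<lambda>x. x ^ m *\<^sub>R (vderiv ^^ n) f x)))"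

definition osc :: "(real \<Rightarrow> complex) \<Rightarrow> real \<Rightarrow> complex" where
  "osc f = (\<lambda>x. - (1/2) *\<^sub>R vderiv (vderiv f) x + (x\<^sup>2 / 2) *\<^sub>R f x)"

definition dil :: "(real \<Rightarrow> complex) \<Rightarrow> real \<Rightarrow> complex" where
  "dil f = (\<lambda>x. x *\<^sub>R vderiv f x + (1/2) *\<^sub>R f x)"

definition matA :: "real \<Rightarrow> real \<Rightarrow> real ^ 2 ^ 2" where
  "matA \<alpha> \<beta> = vector [vector [\<alpha>, 0], vector [0, \<beta>]]"

definition matJ :: "real ^ 2 ^ 2" where
  "matJ = vector [vector [0, -1], vector [1, 0]]"

definition tensor_op ::
  "real ^ 2 ^ 2 \<Rightarrow> ((real \<Rightarrow> complex) \<Rightarrow> real \<Rightarrow> complex) \<Rightarrow> (real \<Rightarrow> complex) ^ 2 \<Rightarrow> (real \<Rightarrow> complex) ^ 2" where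
  "tensor_op M T f = (\<chi> i. (\<lambda>x. \<Sum>j\<in>UNIV. (M $ i $ j) *\<^sub>R T (f $ j) x))"

definition ncho_expr :: "real \<Rightarrow> real \<Rightarrow> (real \<Rightarrow> complex) ^ 2 \<Rightarrow> (real \<Rightarrow> complex) ^ 2" where
  "ncho_expr \<alpha> \<beta> f = (\<chi> i. (\<lambda>x. (tensor_op (matA \<alpha> \<beta>) osc f $ i) x + (tensor_op matJ dil f $ i) x))"

definition class_vec :: "(real \<Rightarrow> complex) ^ 2 \<Rightarrow> L2 ^ 2" where
  "class_vec f = (\<chi> i. abs_L2 (f $ i))"

text \<open>Operators are identified with their graphs. For \<open>\<alpha>, \<beta> > 0\<close>, \<open>\<alpha> * \<beta> > 1\<close>, the differential expression is
  essentially self-adjoint on the Schwartz space, and \<open>ncho \<alpha> \<beta>\<close>, its closure in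
  \<open>\<complex>\<^sup>2 \<otimes> L\<^sup>2(\<real>)\<close>, is the self-adjoint operator \<open>Q(\<alpha>,\<beta>)\<close>. Schwartz functions are
  square-integrable, so the classes formed here are all genuine.\<close>

definition ncho_schwartz :: "real \<Rightarrow> real \<Rightarrow> ((L2 ^ 2) \<times> (L2 ^ 2)) set" where
  "ncho_schwartz \<alpha> \<beta> =
     {(class_vec f, class_vec (ncho_expr \<alpha> \<beta> f)) | f. \<forall>i. schwartz (f $ i)}"

definition ncho :: "real \<Rightarrow> real \<Rightarrow> ((L2 ^ 2) \<times> (L2 ^ 2)) set" where
  "ncho \<alpha> \<beta> = closure (ncho_schwartz \<alpha> \<beta>)"

definition eigenspace :: "((L2 ^ 2) \<times> (L2 ^ 2)) set \<Rightarrow> complex \<Rightarrow> (L2 ^ 2) set" where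
  "eigenspace T z = {u. (u, scaleC_vec z u) \<in> T}"

definition eigenvalue :: "((L2 ^ 2) \<times> (L2 ^ 2)) set \<Rightarrow> complex \<Rightarrow> bool" where
  "eigenvalue T z \<longleftrightarrow> (\<exists>u\<in>eigenspace T z. u \<noteq> 0)"

text \<open>For self-adjoint \<open>T\<close> all eigenvalues are real, so only those are compared.\<close>

definition lowest_eigenvalue :: "((L2 ^ 2) \<times> (L2 ^ 2)) set \<Rightarrow> real \<Rightarrow> bool" where
  "lowest_eigenvalue T E \<longleftrightarrow>
     eigenvalue T (of_real E) \<and> (\<forall>\<mu>. eigenvalue T (of_real \<mu>) \<longrightarrow> E \<le> \<mu>)"

end

theory Submission
  imports Defs "HOL-Probability.Probability" "HOL-Real_Asymp.Real_Asymp"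
begin

text \<open>
  In the Hermite basis \<open>Q(\<alpha>,\<beta>)\<close> is a direct sum of four Jacobi (tridiagonal) operators, two of them
  acting on even and two on odd functions, since \<open>x d/dx + 1/2\<close> shifts the index of a Hermite function
  by \<open>\<plusminus>2\<close> and \<open>J\<close> swaps the components. Write \<open>U\<^sub>n\<close>, \<open>V\<^sub>n\<close> for the Hermite coefficients of
  the two components of an eigenvector.

  The ground state energy satisfies \<open>E \<le> min \<alpha> \<beta> / 2\<close>: in the even sector that starts at the smaller
  diagonal entry, the decaying solution of the three-term recurrence is a continued fraction, and the
  condition that it solves the first equation as well turns it into the fixed point of a contraction.
  For such \<open>E\<close>, a nonzero solution of the recurrence in an odd sector grows faster than the
  coefficients of an \<open>L\<^sup>2\<close> function can, so all odd coefficients vanish and ground states are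
  even. Finally \<open>U\<^sub>0\<close> and \<open>V\<^sub>0\<close> determine all even coefficients, and by completeness of the
  Hermite functions they determine the eigenvector, which bounds the multiplicity by two.
\<close>

section \<open>Rapidly decreasing functions\<close>

text \<open>\<open>lowest_eigenvalue\<close> compares E with eigenvalues only, so the Gaussian as a
  trial vector of energy \<alpha>/2 or \<beta>/2 does not by itself bound E. The bound comes from an
  actual eigenvector, whose series is shown to converge in the graph norm. Conversely, elements of
  the closure \<open>ncho\<close> need not be smooth, so an eigenvector is only ever paired with
  polynomials times a Gaussian; these pairings are continuous in L2, and the operators are moved
  onto the polynomial. The threshold 2 enters twice. With E \<le> \<alpha>/2 the diagonal term
  \<alpha> (n + 1/2) - E is at least \<alpha> n \<ge> 2 n, likewise for \<beta>. The recurrence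
  z_(n+2) = 4 (2 n z_n - n (n-1) z_(n-2)) has the asymptotic ratios (4 \<plusminus> 2 sqrt 3) n,
  while the norms of unnormalised Hermite functions grow by about 2 n per step. From n = 1 on a
  nonzero solution is forced onto the growing branch; at n = 0 the lower bound 2 n degenerates, so
  even solutions may survive. In the even sectors the threshold makes the diagonal entries exceed
  the first one by at least 4 k, which gives the contraction.\<close>

definition rapidly_decreasing :: "(real \<Rightarrow> complex) \<Rightarrow> bool" where
  "rapidly_decreasing f \<longleftrightarrow> continuous_on UNIV f \<and> (\<forall>m. bounded (range (\<lambda>x. x ^ m *\<^sub>R f x)))"

lemma rapidly_decreasing_bound:
  assumes "rapidly_decreasing f"
  obtains C where "\<And>x. \<bar>x\<bar> ^ m * norm (f x) \<le> C"
proof -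
  have "bounded (range (\<lambda>x. x ^ m *\<^sub>R f x))"
    using assms by (auto simp: rapidly_decreasing_def)
  then obtain C where "\<And>x. norm (x ^ m *\<^sub>R f x) \<le> C"
    by (auto simp: bounded_iff)
  then show thesis
    by (intro that[of C]) (simp add: power_abs norm_power)
qed

lemma rapidly_decreasing_isCont: "rapidly_decreasing f \<Longrightarrow> isCont f x"
  by (simp add: rapidly_decreasing_def continuous_on_eq_continuous_at)

lemma rapidly_decreasing_measurable: "rapidly_decreasing f \<Longrightarrow> f \<in> borel_measurable borel"
  by (simp add: rapidly_decreasing_def borel_measurable_continuous_onI)

lemma rapidly_decreasing_add:
  assumes "rapidly_decreasing f" "rapidly_decreasing g"
  shows "rapidly_decreasing (\<lambda>x. f x + g x)"
  using assms by (auto simp: rapidly_decreasing_def scaleR_add_right simp del: complex_scaleR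
      intro!: continuous_intros bounded_plus_comp)

lemma rapidly_decreasing_power_scaleR:
  assumes "rapidly_decreasing f"
  shows "rapidly_decreasing (\<lambda>x. x ^ k *\<^sub>R f x)"
  unfolding rapidly_decreasing_def
proof (intro conjI allI)
  show "continuous_on UNIV (\<lambda>x. x ^ k *\<^sub>R f x)"
    using assms by (auto simp: rapidly_decreasing_def intro!: continuous_intros)
  fix m
  have "bounded (range (\<lambda>x. x ^ (m + k) *\<^sub>R f x))"
    using assms unfolding rapidly_decreasing_def by blast
  then show "bounded (range (\<lambda>x. x ^ m *\<^sub>R x ^ k *\<^sub>R f x))"
    by (simp add: power_add del: complex_scaleR)
qed

text \<open>The class demands no derivatives, so products stay in it without a Leibniz rule for
  higher derivatives.\<close>

lemma rapidly_decreasing_mult: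
  assumes "rapidly_decreasing f" "rapidly_decreasing g"
  shows "rapidly_decreasing (\<lambda>x. f x * g x)"
  unfolding rapidly_decreasing_def
proof (intro conjI allI)
  show "continuous_on UNIV (\<lambda>x. f x * g x)"
    using assms by (auto simp: rapidly_decreasing_def intro!: continuous_intros)
  fix m
  obtain C where C: "\<And>x. \<bar>x\<bar> ^ m * norm (f x) \<le> C" using rapidly_decreasing_bound[OF assms(1), of m] by blast
  obtain D where D: "\<And>x. \<bar>x\<bar> ^ 0 * norm (g x) \<le> D" using rapidly_decreasing_bound[OF assms(2), of 0] by blast
  have "norm (x ^ m *\<^sub>R (f x * g x)) \<le> C * D" for x
  proof -
    have "norm (x ^ m *\<^sub>R (f x * g x)) = (\<bar>x\<bar> ^ m * norm (f x)) * (\<bar>x\<bar> ^ 0 * norm (g x))"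
      by (simp add: norm_mult power_abs norm_power)
    also have "\<dots> \<le> C * D"
      using order_trans[OF _ C, of 0]
      by (intro mult_mono C D) auto
    finally show ?thesis .
  qed
  then show "bounded (range (\<lambda>x. x ^ m *\<^sub>R (f x * g x)))"
    by (auto simp: bounded_iff)
qed

lemma rapidly_decreasing_cmult: "rapidly_decreasing f \<Longrightarrow> rapidly_decreasing (\<lambda>x. c * f x)"
  unfolding rapidly_decreasing_def
proof (intro conjI allI; elim conjE)
  fix m assume b: "\<forall>m. bounded (range (\<lambda>x. x ^ m *\<^sub>R f x))"
  have "bounded ((\<lambda>z. c * z) ` range (\<lambda>x. x ^ m *\<^sub>R f x))"
    by (rule bounded_linear_image[OF b[rule_format] bounded_linear_mult_right])
  then show "bounded (range (\<lambda>x. x ^ m *\<^sub>R (c * f x)))"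
    by (simp add: image_image mult.left_commute)
qed (auto intro!: continuous_intros)

lemma rapidly_decreasing_scaleR: "rapidly_decreasing f \<Longrightarrow> rapidly_decreasing (\<lambda>x. c *\<^sub>R f x)"
  using rapidly_decreasing_cmult[of f "of_real c"] by (simp add: scaleR_conv_of_real)

text \<open>The cases \<open>m = 0\<close> and \<open>m = 2\<close> of the definition add up to an
  integrable majorant that tends to 0; integrability and vanishing boundary terms both come from
  it.\<close>

lemma rapidly_decreasing_inverse_bound:
  assumes "rapidly_decreasing f"
  obtains C where "\<And>x. norm (f x) \<le> C * inverse (1 + x\<^sup>2)"
proof -
  obtain C where C: "\<And>x. \<bar>x\<bar> ^ 0 * norm (f x) \<le> C" using rapidly_decreasing_bound[OF assms, of 0] by blast
  obtain D where D: "\<And>x. \<bar>x\<bar> ^ 2 * norm (f x) \<le> D" using rapidly_decreasing_bound[OF assms, of 2] by blast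
  have "norm (f x) \<le> (C + D) * inverse (1 + x\<^sup>2)" for x
  proof -
    have "(1 + x\<^sup>2) * norm (f x) \<le> C + D"
      using C[of x] D[of x] by (simp add: algebra_simps)
    moreover have "1 + x\<^sup>2 > 0" by (simp add: add_pos_nonneg)
    ultimately show ?thesis by (simp add: field_simps)
  qed
  then show thesis by (rule that)
qed

lemma lborel_integrable_inverse_1_plus_square: "integrable lborel (\<lambda>x::real. inverse (1 + x\<^sup>2))"
proof -
  have [simp]: "einterval (-\<infinity>) \<infinity> = UNIV" by (auto simp: einterval_def)
  show ?thesis
    using Sinc_Integral.integrable_inverse_1_plus_square by (simp add: set_integrable_def)
qed

lemma rapidly_decreasing_integrable:
  assumes "rapidly_decreasing f" shows "integrable lborel f"
proof -
  obtain C where C: "\<And>x. norm (f x) \<le> C * inverse (1 + x\<^sup>2)"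
    using rapidly_decreasing_inverse_bound[OF assms] by blast
  show ?thesis
    by (rule Bochner_Integration.integrable_bound
        [OF integrable_mult_right[OF lborel_integrable_inverse_1_plus_square, of C]])
      (use C rapidly_decreasing_measurable[OF assms] in \<open>auto intro: order_trans[OF C abs_ge_self]\<close>)
qed

lemma rapidly_decreasing_square_integrable:
  assumes "rapidly_decreasing f" shows "square_integrable f"
  unfolding square_integrable_def
proof
  show "f \<in> borel_measurable lborel" using rapidly_decreasing_measurable[OF assms] by simp
  have "integrable lborel (\<lambda>x. norm (f x * f x))"
    by (intro integrable_norm rapidly_decreasing_integrable rapidly_decreasing_mult assms)
  then show "integrable lborel (\<lambda>x. (norm (f x))\<^sup>2)"
    by (simp add: norm_mult power2_eq_square)
qed

lemma tendsto_inverse_1_plus_square: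
  "((\<lambda>x::real. C * inverse (1 + x\<^sup>2)) \<longlongrightarrow> 0) at_top"
  "((\<lambda>x::real. C * inverse (1 + x\<^sup>2)) \<longlongrightarrow> 0) at_bot"
  by real_asymp+

lemma rapidly_decreasing_tendsto_0:
  assumes "rapidly_decreasing f"
  shows "(f \<longlongrightarrow> 0) at_top" "(f \<longlongrightarrow> 0) at_bot"
proof -
  obtain C where C: "\<And>x. norm (f x) \<le> C * inverse (1 + x\<^sup>2)"
    using rapidly_decreasing_inverse_bound[OF assms] by blast
  show "(f \<longlongrightarrow> 0) at_top"
    by (rule Lim_null_comparison[OF always_eventually tendsto_inverse_1_plus_square(1)[of C]])
      (simp add: C)
  show "(f \<longlongrightarrow> 0) at_bot"
    by (rule Lim_null_comparison[OF always_eventually tendsto_inverse_1_plus_square(2)[of C]])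
      (simp add: C)
qed

lemma integral_derivative_rapidly_decreasing:
  assumes F: "\<And>x. (F has_vector_derivative f x) (at x)" and "rapidly_decreasing F" "rapidly_decreasing f"
  shows "(LINT x|lborel. f x) = 0"
proof -
  have [simp]: "einterval (-\<infinity>) \<infinity> = UNIV" by (auto simp: einterval_def)
  have "(LBINT x=-\<infinity>..\<infinity>. f x) = 0 - 0"
  proof (rule interval_integral_FTC_integrable)
    show "set_integrable lborel (einterval (- \<infinity>) \<infinity>) f"
      using rapidly_decreasing_integrable[OF assms(3)] by (simp add: set_integrable_def)
    show "((F \<circ> real_of_ereal) \<longlongrightarrow> 0) (at_right (-\<infinity>))"
      using rapidly_decreasing_tendsto_0(2)[OF assms(2)]
      by (simp add: ereal_tendsto_simps1)
    show "((F \<circ> real_of_ereal) \<longlongrightarrow> 0) (at_left \<infinity>)"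
      using rapidly_decreasing_tendsto_0(1)[OF assms(2)]
      by (simp add: ereal_tendsto_simps1)
  qed (use F rapidly_decreasing_isCont[OF assms(3)] in auto)
  then show ?thesis
    by (simp add: interval_lebesgue_integral_def set_lebesgue_integral_def)
qed

lemma rapidly_decreasing_integration_by_parts:
  assumes F: "\<And>x. (f has_vector_derivative f' x) (at x)"
    and G: "\<And>x. (g has_vector_derivative g' x) (at x)"
    and r: "rapidly_decreasing f" "rapidly_decreasing f'" "rapidly_decreasing g" "rapidly_decreasing g'"
  shows "(LINT x|lborel. f' x * g x) = - (LINT x|lborel. f x * g' x)"
proof -
  have "(LINT x|lborel. f x * g' x + f' x * g x) = 0"
    by (rule integral_derivative_rapidly_decreasing[of "\<lambda>x. f x * g x"])
      (intro has_vector_derivative_mult F G rapidly_decreasing_mult rapidly_decreasing_add r)+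
  also have "(LINT x|lborel. f x * g' x + f' x * g x) =
      (LINT x|lborel. f x * g' x) + (LINT x|lborel. f' x * g x)"
    by (intro Bochner_Integration.integral_add rapidly_decreasing_integrable rapidly_decreasing_mult r)
  finally show ?thesis by (simp add: eq_neg_iff_add_eq_0 add.commute)
qed

lemma schwartz_vderiv:
  assumes "schwartz f"
  shows "((vderiv ^^ n) f has_vector_derivative (vderiv ^^ Suc n) f x) (at x)"
  using assms by (auto simp: schwartz_def vderiv_def vector_derivative_works)

lemma schwartz_imp_rapidly_decreasing:
  assumes "schwartz f"
  shows "rapidly_decreasing ((vderiv ^^ n) f)"
  using assms unfolding rapidly_decreasing_def schwartz_def
  by (auto simp: continuous_on_eq_continuous_at differentiable_imp_continuous_within)

lemma schwartz_imp_rapidly_decreasing_012: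
  assumes "schwartz f"
  shows "rapidly_decreasing f" "rapidly_decreasing (vderiv f)" "rapidly_decreasing (vderiv (vderiv f))"
  using schwartz_imp_rapidly_decreasing[OF assms, of 0] schwartz_imp_rapidly_decreasing[OF assms, of 1]
    schwartz_imp_rapidly_decreasing[OF assms, of 2] by (simp_all add: numeral_2_eq_2)

lemma schwartz_has_vector_derivative:
  assumes "schwartz f"
  shows "(f has_vector_derivative vderiv f x) (at x)"
    "(vderiv f has_vector_derivative vderiv (vderiv f) x) (at x)"
  using schwartz_vderiv[OF assms, of 0] schwartz_vderiv[OF assms, of 1] by simp_all

section \<open>Polynomials times a Gaussian\<close>

definition gpoly :: "real poly \<Rightarrow> real \<Rightarrow> complex" where
  "gpoly p x = of_real (poly p x * exp (- x\<^sup>2 / 2))"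

text \<open>d/dx conjugated by the Gaussian.\<close>

definition gder :: "real poly \<Rightarrow> real poly" where
  "gder p = pderiv p - pCons 0 p"

lemma gpoly_has_vector_derivative: "(gpoly p has_vector_derivative gpoly (gder p) x) (at x)"
proof -
  have "((\<lambda>x. poly p x * exp (- x\<^sup>2 / 2)) has_vector_derivative
      poly (gder p) x * exp (- x\<^sup>2 / 2)) (at x)"
    unfolding has_real_derivative_iff_has_vector_derivative[symmetric]
    by (auto intro!: derivative_eq_intros poly_DERIV simp: gder_def algebra_simps power2_eq_square)
  then show ?thesis
    unfolding gpoly_def by (rule bounded_linear.has_vector_derivative[OF bounded_linear_of_real])
qed

lemma vderiv_gpoly: "vderiv (gpoly p) = gpoly (gder p)"
  unfolding vderiv_def using vector_derivative_at[OF gpoly_has_vector_derivative] by blast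

lemma vderiv_funpow_gpoly: "(vderiv ^^ n) (gpoly p) = gpoly ((gder ^^ n) p)"
  by (induction n) (simp_all add: vderiv_gpoly)

text \<open>\<open>m\<close> varies in the induction because the factor x in front of
  \<open>p\<close> is absorbed by raising \<open>m\<close> by one.\<close>

lemma bounded_poly_gaussian:
  "\<exists>C. \<forall>x::real. \<bar>x\<bar> ^ m * \<bar>poly p x\<bar> * exp (- x\<^sup>2 / 2) \<le> C"
proof (induction p arbitrary: m)
  case 0
  show ?case by (intro exI[of _ 0]) simp
next
  case (pCons a p)
  obtain C where C: "\<And>x::real. \<bar>x\<bar> ^ Suc m * \<bar>poly p x\<bar> * exp (- x\<^sup>2 / 2) \<le> C"
    using pCons.IH[of "Suc m"] by blast
  \<comment> \<open>One term of the exponential series gives |x|^m \<le> m! e^|x|, and |x| - x^2/2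
    \<le> 1/2.\<close>
  have D: "\<bar>x\<bar> ^ m * exp (- x\<^sup>2 / 2) \<le> fact m * exp (1 / 2)" for x :: real
  proof -
    have "(\<Sum>n\<in>{m}. \<bar>x\<bar> ^ n /\<^sub>R fact n) \<le> exp \<bar>x\<bar>"
      unfolding exp_def by (intro sum_le_suminf summable_exp_generic) auto
    then have "\<bar>x\<bar> ^ m \<le> fact m * exp \<bar>x\<bar>"
      by (simp add: field_simps)
    then have "\<bar>x\<bar> ^ m * exp (- x\<^sup>2 / 2) \<le> fact m * (exp \<bar>x\<bar> * exp (- x\<^sup>2 / 2))"
      by (simp add: mult_right_mono flip: mult.assoc)
    also have "exp \<bar>x\<bar> * exp (- x\<^sup>2 / 2) \<le> exp (1 / 2)"
      using zero_le_power2[of "\<bar>x\<bar> - 1"] by (simp add: power2_diff flip: exp_add)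
    finally show ?thesis by simp
  qed
  have "\<bar>x\<bar> ^ m * \<bar>poly (pCons a p) x\<bar> * exp (- x\<^sup>2 / 2) \<le> \<bar>a\<bar> * (fact m * exp (1 / 2)) + C" for x
  proof -
    have "\<bar>x\<bar> ^ m * \<bar>poly (pCons a p) x\<bar> * exp (- x\<^sup>2 / 2)
        \<le> \<bar>x\<bar> ^ m * (\<bar>a\<bar> + \<bar>x\<bar> * \<bar>poly p x\<bar>) * exp (- x\<^sup>2 / 2)"
      using abs_triangle_ineq[of a "x * poly p x"]
      by (intro mult_right_mono mult_left_mono) (auto simp: abs_mult)
    also have "\<dots> = \<bar>a\<bar> * (\<bar>x\<bar> ^ m * exp (- x\<^sup>2 / 2)) + \<bar>x\<bar> ^ Suc m * \<bar>poly p x\<bar> * exp (- x\<^sup>2 / 2)"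
      by (simp add: algebra_simps)
    also have "\<dots> \<le> \<bar>a\<bar> * (fact m * exp (1 / 2)) + C"
      by (intro add_mono mult_left_mono C D) auto
    finally show ?thesis .
  qed
  then show ?case by blast
qed

lemma schwartz_gpoly: "schwartz (gpoly p)"
  unfolding schwartz_def vderiv_funpow_gpoly
proof (intro conjI allI)
  show "gpoly ((gder ^^ n) p) differentiable at x" for n x
    using gpoly_has_vector_derivative by (rule differentiableI_vector)
  fix m n
  obtain C where "\<And>x::real. \<bar>x\<bar> ^ m * \<bar>poly ((gder ^^ n) p) x\<bar> * exp (- x\<^sup>2 / 2) \<le> C"
    using bounded_poly_gaussian by blast
  then show "bounded (range (\<lambda>x. x ^ m *\<^sub>R gpoly ((gder ^^ n) p) x))"
    by (auto simp: bounded_iff gpoly_def norm_mult norm_power power_abs mult.assoc intro!: exI[of _ C])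
qed

lemmas rapidly_decreasing_gpoly = schwartz_imp_rapidly_decreasing_012(1)[OF schwartz_gpoly]

lemma square_integrable_gpoly: "square_integrable (gpoly p)" "square_integrable (\<lambda>x. c * gpoly p x)"
  by (intro rapidly_decreasing_square_integrable rapidly_decreasing_gpoly rapidly_decreasing_cmult)+

lemma gpoly_add: "gpoly (p + q) x = gpoly p x + gpoly q x"
  and gpoly_diff: "gpoly (p - q) x = gpoly p x - gpoly q x"
  and gpoly_smult: "gpoly (smult c p) x = of_real c * gpoly p x"
  and gpoly_pCons_0: "gpoly (pCons 0 p) x = of_real x * gpoly p x"
  by (simp_all add: gpoly_def algebra_simps)

section \<open>Computing in \<open>L2\<close> with representatives\<close>

lemma L2_rel_refl: "L2_rel f f \<longleftrightarrow> square_integrable f"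
  by (simp add: L2_rel_def)

lemma abs_L2_add: "square_integrable f \<Longrightarrow> square_integrable g \<Longrightarrow>
    abs_L2 f + abs_L2 g = abs_L2 (\<lambda>x. f x + g x)"
  by (simp add: plus_L2.abs_eq eq_onp_def L2_rel_refl)

lemma abs_L2_diff: "square_integrable f \<Longrightarrow> square_integrable g \<Longrightarrow>
    abs_L2 f - abs_L2 g = abs_L2 (\<lambda>x. f x - g x)"
  by (simp add: minus_L2.abs_eq eq_onp_def L2_rel_refl)

lemma abs_L2_scaleR: "square_integrable f \<Longrightarrow> r *\<^sub>R abs_L2 f = abs_L2 (\<lambda>x. r *\<^sub>R f x)"
  by (simp add: scaleR_L2.abs_eq eq_onp_def L2_rel_refl)

lemma abs_L2_scaleC: "square_integrable f \<Longrightarrow> scaleC_L2 c (abs_L2 f) = abs_L2 (\<lambda>x. c * f x)"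
  by (simp add: scaleC_L2.abs_eq eq_onp_def L2_rel_refl)

lemma abs_L2_inner: "square_integrable f \<Longrightarrow> square_integrable g \<Longrightarrow>
    abs_L2 f \<bullet> abs_L2 g = (LINT x|lborel. f x \<bullet> g x)"
  by (simp add: inner_L2.abs_eq eq_onp_def L2_rel_refl)

lemma abs_L2_eq_0_iff: "square_integrable f \<Longrightarrow> abs_L2 f = 0 \<longleftrightarrow> (AE x in lborel. f x = 0)"
  unfolding zero_L2_def
  using Quotient_rel[OF Quotient_L2, of f "\<lambda>x. 0"] by (auto simp: L2_rel_def square_integrable_zero)

lemma L2_exhaust:
  obtains f where "square_integrable f" "u = abs_L2 f"
  by (metis L2_rel_refl Quotient_L2 Quotient_abs_rep Quotient_rep_reflp)

section \<open>Pairing with Gaussian polynomials; Hermite polynomials\<close>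

lemma square_integrable_mult_integrable:
  assumes "square_integrable f" "square_integrable g"
  shows "integrable lborel (\<lambda>x. f x * g x)"
proof -
  have [measurable]: "f \<in> borel_measurable lborel" "g \<in> borel_measurable lborel"
    using assms by (auto simp: square_integrable_def)
  have "integrable lborel (\<lambda>x. (norm (f x))\<^sup>2 + (norm (g x))\<^sup>2)"
    using assms by (auto simp: square_integrable_def)
  moreover have "norm (f x) * norm (g x) \<le> (norm (f x))\<^sup>2 + (norm (g x))\<^sup>2" for x
  proof -
    have "2 * (norm (f x) * norm (g x)) \<le> (norm (f x))\<^sup>2 + (norm (g x))\<^sup>2"
      using sum_squares_bound[of "norm (f x)" "norm (g x)"] by simp
    moreover have "0 \<le> norm (f x) * norm (g x)" by simp
    ultimately show ?thesis by linarith
  qed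
  ultimately show ?thesis
    by (elim Bochner_Integration.integrable_bound) (auto simp: norm_mult)
qed

text \<open>The complex pairing is recovered from the real inner product of \<open>L2\<close>, so that its continuity is
  that of \<open>inner\<close>.\<close>

definition gpair :: "real poly \<Rightarrow> L2 \<Rightarrow> complex" where
  "gpair p u = Complex (u \<bullet> abs_L2 (gpoly p)) (u \<bullet> abs_L2 (\<lambda>x. \<i> * gpoly p x))"

lemma Im_gpoly [simp]: "Im (gpoly p x) = 0"
  by (simp add: gpoly_def)

lemma gpair_abs_L2:
  assumes "square_integrable f"
  shows "gpair p (abs_L2 f) = (LINT x|lborel. f x * gpoly p x)"
proof (rule complex_eqI)
  note i = square_integrable_mult_integrable[OF assms square_integrable_gpoly(1)]
  show "Re (gpair p (abs_L2 f)) = Re (LINT x|lborel. f x * gpoly p x)"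
    unfolding gpair_def integral_Re[OF i, symmetric]
    by (simp add: abs_L2_inner assms square_integrable_gpoly inner_complex_def)
  show "Im (gpair p (abs_L2 f)) = Im (LINT x|lborel. f x * gpoly p x)"
    unfolding gpair_def integral_Im[OF i, symmetric]
    by (simp add: abs_L2_inner assms square_integrable_gpoly inner_complex_def)
qed

lemma gpair_add: "gpair p (u + v) = gpair p u + gpair p v"
  and gpair_diff: "gpair p (u - v) = gpair p u - gpair p v"
  and gpair_0: "gpair p 0 = 0"
  and gpair_scaleR: "gpair p (r *\<^sub>R u) = of_real r * gpair p u"
  by (simp_all add: gpair_def inner_add_left inner_diff_left complex_eq_iff)

lemma tendsto_gpair: "(f \<longlongrightarrow> u) F \<Longrightarrow> ((\<lambda>x. gpair p (f x)) \<longlongrightarrow> gpair p u) F"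
  unfolding gpair_def by (intro tendsto_intros)

lemma continuous_on_gpair: "continuous_on S f \<Longrightarrow> continuous_on S (\<lambda>x. gpair p (f x))"
  by (auto simp: continuous_on_def intro: tendsto_gpair)

lemma gpair_scaleC: "gpair p (scaleC_L2 c u) = c * gpair p u"
proof -
  obtain f where f: "square_integrable f" "u = abs_L2 f" by (rule L2_exhaust)
  show ?thesis
    by (simp add: f abs_L2_scaleC gpair_abs_L2 square_integrable_cmult mult.assoc)
qed

lemma gpair_poly_add: "gpair (p + q) u = gpair p u + gpair q u"
  and gpair_poly_diff: "gpair (p - q) u = gpair p u - gpair q u"
  and gpair_poly_smult: "gpair (smult c p) u = of_real c * gpair p u"
proof -
  obtain f where f: "square_integrable f" "u = abs_L2 f" by (rule L2_exhaust)
  note i = square_integrable_mult_integrable[OF f(1) square_integrable_gpoly(1)]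
  show "gpair (p + q) u = gpair p u + gpair q u"
    by (simp add: f gpair_abs_L2 gpoly_add distrib_left i)
  show "gpair (p - q) u = gpair p u - gpair q u"
    by (simp add: f gpair_abs_L2 gpoly_diff right_diff_distrib i)
  show "gpair (smult c p) u = of_real c * gpair p u"
    by (simp add: f gpair_abs_L2 gpoly_smult mult.left_commute)
qed

text \<open>The factor 2 comes from bounding the modulus by |Re| + |Im|; a constant factor is
  harmless in the growth comparison.\<close>

lemma norm_gpair_le: "norm (gpair p u) \<le> 2 * (norm u * norm (abs_L2 (gpoly p)))"
proof -
  have n: "norm (abs_L2 (\<lambda>x. \<i> * gpoly p x)) = norm (abs_L2 (gpoly p))"
    unfolding norm_eq_sqrt_inner
    by (simp add: abs_L2_inner square_integrable_gpoly inner_complex_def add.commute)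
  have "norm (gpair p u) \<le> \<bar>Re (gpair p u)\<bar> + \<bar>Im (gpair p u)\<bar>" by (rule cmod_le)
  also have "\<dots> \<le> norm u * norm (abs_L2 (gpoly p)) + norm u * norm (abs_L2 (gpoly p))"
    using Cauchy_Schwarz_ineq2[of u "abs_L2 (gpoly p)"]
      Cauchy_Schwarz_ineq2[of u "abs_L2 (\<lambda>x. \<i> * gpoly p x)"]
    by (intro add_mono) (simp_all add: gpair_def n)
  finally show ?thesis by simp
qed

lemma gpair_vderiv:
  assumes "schwartz f"
  shows "(LINT x|lborel. vderiv f x * gpoly p x) = - (LINT x|lborel. f x * gpoly (gder p) x)"
  by (intro rapidly_decreasing_integration_by_parts schwartz_has_vector_derivative schwartz_imp_rapidly_decreasing_012
      gpoly_has_vector_derivative rapidly_decreasing_gpoly assms)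

section \<open>Transposes of the two differential operators\<close>

definition osc_poly :: "real poly \<Rightarrow> real poly" where
  "osc_poly p = smult (1/2) (pCons 0 (pCons 0 p)) - smult (1/2) (gder (gder p))"

definition dil_poly :: "real poly \<Rightarrow> real poly" where
  "dil_poly p = pCons 0 (gder p) + smult (1/2) p"

lemma osc_gpoly: "osc (gpoly p) = gpoly (osc_poly p)"
  by (simp add: fun_eq_iff osc_def vderiv_gpoly osc_poly_def gpoly_diff gpoly_smult
      gpoly_pCons_0 power2_eq_square scaleR_conv_of_real del: smult_pCons)

lemma dil_gpoly: "dil (gpoly p) = gpoly (dil_poly p)"
  by (simp add: fun_eq_iff dil_def vderiv_gpoly dil_poly_def gpoly_add gpoly_smult
      gpoly_pCons_0 scaleR_conv_of_real)

lemma rapidly_decreasing_osc: "schwartz f \<Longrightarrow> rapidly_decreasing (osc f)"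
  and rapidly_decreasing_dil: "schwartz f \<Longrightarrow> rapidly_decreasing (dil f)"
proof -
  assume f: "schwartz f"
  note r = schwartz_imp_rapidly_decreasing_012[OF f]
  have *: "osc f = (\<lambda>x. (- (1/2)) *\<^sub>R vderiv (vderiv f) x + (1/2) *\<^sub>R x ^ 2 *\<^sub>R f x)"
    by (simp add: fun_eq_iff osc_def)
  show "rapidly_decreasing (osc f)"
    unfolding * by (intro rapidly_decreasing_add rapidly_decreasing_scaleR rapidly_decreasing_power_scaleR r)
  have *: "dil f = (\<lambda>x. x ^ 1 *\<^sub>R vderiv f x + (1/2) *\<^sub>R f x)"
    by (simp add: fun_eq_iff dil_def)
  show "rapidly_decreasing (dil f)"
    unfolding * by (intro rapidly_decreasing_add rapidly_decreasing_scaleR rapidly_decreasing_power_scaleR r)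
qed

lemma gpair_osc:
  assumes f: "schwartz f"
  shows "gpair p (abs_L2 (osc f)) = gpair (osc_poly p) (abs_L2 f)"
proof -
  note r = schwartz_imp_rapidly_decreasing_012[OF f]
  have d2: "(LINT x|lborel. vderiv (vderiv f) x * gpoly p x) = (LINT x|lborel. f x * gpoly (gder (gder p)) x)"
  proof -
    have "(LINT x|lborel. vderiv (vderiv f) x * gpoly p x) = - (LINT x|lborel. vderiv f x * gpoly (gder p) x)"
      by (intro rapidly_decreasing_integration_by_parts schwartz_has_vector_derivative r
        gpoly_has_vector_derivative rapidly_decreasing_gpoly f)
    then show ?thesis by (simp add: gpair_vderiv f)
  qed
  have i: "integrable lborel (\<lambda>x. vderiv (vderiv f) x * gpoly p x)"
    "integrable lborel (\<lambda>x. f x * gpoly q x)" for q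
    by (intro rapidly_decreasing_integrable rapidly_decreasing_mult r rapidly_decreasing_gpoly)+
  have "gpair p (abs_L2 (osc f)) = (LINT x|lborel. - (1/2) * (vderiv (vderiv f) x * gpoly p x) +
     (1/2) * (f x * gpoly (pCons 0 (pCons 0 p)) x))"
    unfolding gpair_abs_L2[OF rapidly_decreasing_square_integrable[OF rapidly_decreasing_osc[OF f]]]
    by (simp add: osc_def scaleR_conv_of_real gpoly_pCons_0 algebra_simps power2_eq_square)
  also have "\<dots> = - (1/2) * (LINT x|lborel. f x * gpoly (gder (gder p)) x) +
      (1/2) * (LINT x|lborel. f x * gpoly (pCons 0 (pCons 0 p)) x)"
    by (subst Bochner_Integration.integral_add)
      (auto simp: i d2 intro!: integrable_mult_right)
  also have "\<dots> = gpair (osc_poly p) (abs_L2 f)"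
    by (simp add: osc_poly_def gpair_poly_diff gpair_poly_smult gpair_abs_L2
        rapidly_decreasing_square_integrable r del: smult_pCons)
  finally show ?thesis .
qed

text \<open>Integration by parts turns x d/dx into -(x d/dx + 1), so the summand 1/2 is exactly what
  makes the operator antisymmetric.\<close>

lemma gpair_dil:
  assumes f: "schwartz f"
  shows "gpair p (abs_L2 (dil f)) = - gpair (dil_poly p) (abs_L2 f)"
proof -
  note r = schwartz_imp_rapidly_decreasing_012[OF f]
  have i: "integrable lborel (\<lambda>x. vderiv f x * gpoly q x)"
    "integrable lborel (\<lambda>x. f x * gpoly q x)" for q
    by (intro rapidly_decreasing_integrable rapidly_decreasing_mult r rapidly_decreasing_gpoly)+
  have g: "gder (pCons 0 p) = dil_poly p + smult (1/2) p"
    by (rule poly_ext) (simp add: gder_def dil_poly_def pderiv_pCons algebra_simps)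
  have "gpair p (abs_L2 (dil f)) = (LINT x|lborel. vderiv f x * gpoly (pCons 0 p) x +
     (1/2) * (f x * gpoly p x))"
    unfolding gpair_abs_L2[OF rapidly_decreasing_square_integrable[OF rapidly_decreasing_dil[OF f]]]
    by (simp add: dil_def scaleR_conv_of_real gpoly_pCons_0 algebra_simps)
  also have "\<dots> = - (LINT x|lborel. f x * gpoly (gder (pCons 0 p)) x) +
      (1/2) * (LINT x|lborel. f x * gpoly p x)"
    by (subst Bochner_Integration.integral_add)
      (auto simp: i gpair_vderiv f intro!: integrable_mult_right)
  also have "\<dots> = - gpair (gder (pCons 0 p)) (abs_L2 f) + (1/2) * gpair p (abs_L2 f)"
    by (simp add: gpair_abs_L2 rapidly_decreasing_square_integrable r)
  also have "\<dots> = - gpair (dil_poly p) (abs_L2 f)"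
    unfolding g gpair_poly_add gpair_poly_smult by simp
  finally show ?thesis .
qed

section \<open>Hermite polynomials (physicists' convention) and ladder operators\<close>

primrec hermite :: "nat \<Rightarrow> real poly" where
  "hermite 0 = 1"
| "hermite (Suc n) = smult 2 (pCons 0 (hermite n)) - pderiv (hermite n)"

text \<open>\<open>pderiv\<close> and the raising step 2 x - d/dx commute up to the constant 2, so
  every step up contributes another 2 \<open>hermite n\<close>.\<close>

lemma pderiv_hermite: "pderiv (hermite n) = smult (2 * real n) (hermite (n - 1))"
proof (induction n)
  case (Suc n)
  show ?case
  proof (cases n)
    case 0
    then show ?thesis
      by (intro poly_ext) (simp add: pderiv_pCons pderiv_diff pderiv_smult)
  next
    case (Suc m)
    have "pderiv (hermite (Suc n)) = smult 2 (hermite n) + (smult 2 (pCons 0 (pderiv (hermite n)))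
        - pderiv (pderiv (hermite n)))"
      by (intro poly_ext) (simp add: pderiv_pCons pderiv_diff pderiv_smult algebra_simps)
    also have "pderiv (hermite n) = smult (2 * real n) (hermite m)"
      using Suc.IH Suc by simp
    also have "smult 2 (pCons 0 (smult (2 * real n) (hermite m))) - pderiv (smult (2 * real n) (hermite m))
        = smult (2 * real n) (hermite n)"
      unfolding Suc hermite.simps
      by (intro poly_ext) (simp add: pderiv_smult algebra_simps)
    finally show ?thesis
      by (intro poly_ext) (simp add: algebra_simps)
  qed
qed simp

text \<open>With D = \<open>pderiv\<close> and R = 2 x - D, the oscillator acts on polynomials as (R
  D + 1)/2, and R D multiplies \<open>hermite n\<close> by 2 n.\<close>

lemma osc_hermite: "osc_poly (hermite n) = smult (real n + 1/2) (hermite n)"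
proof -
  have "osc_poly (hermite n) = smult (1/2) (hermite n) + smult (1/2)
      (smult 2 (pCons 0 (pderiv (hermite n))) - pderiv (pderiv (hermite n)))"
    by (intro poly_ext) (simp add: osc_poly_def gder_def pderiv_pCons pderiv_diff algebra_simps)
  also have "smult 2 (pCons 0 (pderiv (hermite n))) - pderiv (pderiv (hermite n)) =
      smult (2 * real n) (hermite n)"
  proof (cases n)
    case (Suc m)
    show ?thesis
      unfolding pderiv_hermite[of n] pderiv_smult
      by (intro poly_ext) (simp add: Suc algebra_simps)
  qed simp
  finally show ?thesis
    by (intro poly_ext) (simp add: algebra_simps)
qed

text \<open>With D = \<open>pderiv\<close> and R = 2 x - D, the dilation generator is (D^2 - R^2)/4,
  hence the index shifts by two.\<close>

lemma dil_hermite: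
  "dil_poly (hermite n) = smult (real n * real (n - 1)) (hermite (n - 2)) - smult (1/4) (hermite (n + 2))"
proof -
  have "dil_poly (hermite n) = smult (1/4) (pderiv (pderiv (hermite n))) - smult (1/4) (hermite (Suc (Suc n)))"
    by (intro poly_ext) (simp add: dil_poly_def gder_def pderiv_pCons pderiv_diff pderiv_smult algebra_simps)
  also have "pderiv (pderiv (hermite n)) = smult (4 * real n * real (n - 1)) (hermite (n - 2))"
    unfolding pderiv_hermite[of n] pderiv_smult pderiv_hermite[of "n - 1"]
    by (intro poly_ext) (simp add: numeral_2_eq_2)
  finally show ?thesis by (simp del: hermite.simps)
qed

section \<open>Recurrences for the Hermite coefficients of eigenvectors\<close>

text \<open>Left unnormalised, so that the recurrences have coefficients polynomial in the index
  instead of square roots.\<close>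

definition hermite_fun :: "nat \<Rightarrow> L2" where
  "hermite_fun n = abs_L2 (gpoly (hermite n))"

lemma gpair_gpoly: "gpair p (abs_L2 (gpoly q)) = (LINT x|lborel. gpoly q x * gpoly p x)"
  by (simp add: gpair_abs_L2 square_integrable_gpoly)

lemma gpair_gpoly_commute: "gpair p (abs_L2 (gpoly q)) = gpair q (abs_L2 (gpoly p))"
  by (simp add: gpair_gpoly mult.commute)

lemma hermite_Suc: "hermite (Suc n) = pCons 0 (hermite n) - gder (hermite n)"
  by (intro poly_ext) (simp add: gder_def algebra_simps)

text \<open>On functions the left-hand side applies x - d/dx, whose transpose x + d/dx merely
  differentiates the polynomial factor \<open>q\<close>.\<close>

lemma gpair_creation:
  "gpair (pCons 0 p - gder p) (abs_L2 (gpoly q)) = gpair p (abs_L2 (gpoly (pderiv q)))"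
proof -
  have "gpair (gder p) (abs_L2 (gpoly q)) = - gpair p (abs_L2 (gpoly (gder q)))"
    using gpair_vderiv[OF schwartz_gpoly, of q p] by (simp add: gpair_gpoly vderiv_gpoly)
  moreover have "gpair (pCons 0 p) (abs_L2 (gpoly q)) = gpair p (abs_L2 (gpoly (pCons 0 q)))"
    by (simp add: gpair_gpoly gpoly_pCons_0 algebra_simps)
  moreover have "pderiv q = pCons 0 q + gder q" by (simp add: gder_def)
  ultimately show ?thesis
    unfolding gpair_poly_diff by (simp add: gpair_gpoly_commute[of p] gpair_poly_add)
qed

lemma norm_gpoly: "(norm (abs_L2 (gpoly p)))\<^sup>2 = Re (gpair p (abs_L2 (gpoly p)))"
  by (simp add: gpair_def power2_norm_eq_inner)

lemma norm_hermite_fun_Suc: "(norm (hermite_fun (Suc n)))\<^sup>2 = 2 * real (Suc n) * (norm (hermite_fun n))\<^sup>2"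
proof -
  have "gpair (hermite (Suc n)) (hermite_fun (Suc n)) = gpair (hermite n) (abs_L2 (gpoly (pderiv (hermite (Suc n)))))"
    unfolding hermite_fun_def by (subst hermite_Suc) (rule gpair_creation)
  also have "\<dots> = gpair (pderiv (hermite (Suc n))) (hermite_fun n)"
    unfolding hermite_fun_def by (rule gpair_gpoly_commute)
  also have "\<dots> = of_real (2 * real (Suc n)) * gpair (hermite n) (hermite_fun n)"
    unfolding pderiv_hermite[of "Suc n"] gpair_poly_smult by simp
  finally show ?thesis
    unfolding hermite_fun_def norm_gpoly by (simp del: hermite.simps of_nat_Suc)
qed

text \<open>The raising operator moves off \<open>hermite (Suc n)\<close> and differentiates 1. This
  orthogonality later shows that the constructed eigenvector is nonzero.\<close>

lemma gpair_0_hermite_fun_Suc: "gpair (hermite 0) (hermite_fun (Suc n)) = 0"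
  using gpair_creation[of "hermite n" "1"]
  unfolding hermite_fun_def hermite_Suc[symmetric]
  by (simp add: gpair_gpoly_commute[of 1] del: hermite.simps(2)) (simp add: gpair_gpoly gpoly_def)

lemma hermite_fun_0_neq_0: "hermite_fun 0 \<noteq> 0"
proof
  assume "hermite_fun 0 = 0"
  then have "AE x in lborel. gpoly 1 x = 0"
    by (simp add: hermite_fun_def abs_L2_eq_0_iff square_integrable_gpoly)
  then have "AE x in (lborel :: real measure). False"
    by (rule eventually_mono) (simp add: gpoly_def)
  then show False
    using AE_iff_measurable[of UNIV "lborel :: real measure" "\<lambda>x. False"] by simp
qed

lemma norm_hermite_fun_pos: "norm (hermite_fun n) > 0"
proof (induction n)
  case 0
  then show ?case using hermite_fun_0_neq_0 by simp
next
  case (Suc n)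
  then have "(norm (hermite_fun (Suc n)))\<^sup>2 > 0" unfolding norm_hermite_fun_Suc by simp
  then show ?case by (simp add: zero_less_power2)
qed

lemma gpair_0_hermite_fun_0_neq_0: "gpair (hermite 0) (hermite_fun 0) \<noteq> 0"
proof
  assume "gpair (hermite 0) (hermite_fun 0) = 0"
  then have "(norm (hermite_fun 0))\<^sup>2 = 0" unfolding hermite_fun_def norm_gpoly by simp
  then show False using norm_hermite_fun_pos[of 0] by simp
qed

text \<open>The exact factor 2 sqrt ((n + 1) (n + 2)) is rounded up to remove the root; growth of
  the odd coefficients and convergence of the eigenvector series both use an upper bound.\<close>

lemma norm_hermite_fun_step: "norm (hermite_fun (n + 2)) \<le> 2 * real (n + 2) * norm (hermite_fun n)"
proof (rule power2_le_imp_le)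
  have "(norm (hermite_fun (n + 2)))\<^sup>2 = (2 * real (n + 2)) * (2 * real (n + 1)) * (norm (hermite_fun n))\<^sup>2"
    by (simp add: norm_hermite_fun_Suc del: of_nat_Suc)
  also have "\<dots> \<le> (2 * real (n + 2)) * (2 * real (n + 2)) * (norm (hermite_fun n))\<^sup>2"
    by (intro mult_right_mono mult_left_mono) auto
  finally show "(norm (hermite_fun (n + 2)))\<^sup>2 \<le> (2 * real (n + 2) * norm (hermite_fun n))\<^sup>2"
    by (simp add: power2_eq_square algebra_simps)
qed auto

section \<open>The eigenvalue equation tested against Hermite functions\<close>

lemma ncho_expr_1: "ncho_expr \<alpha> \<beta> f $ 1 = (\<lambda>x. \<alpha> *\<^sub>R osc (f $ 1) x - dil (f $ 2) x)"
  and ncho_expr_2: "ncho_expr \<alpha> \<beta> f $ 2 = (\<lambda>x. \<beta> *\<^sub>R osc (f $ 2) x + dil (f $ 1) x)"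
  by (simp_all add: ncho_expr_def tensor_op_def matA_def matJ_def UNIV_2 fun_eq_iff)

lemma class_vec_ncho_expr:
  assumes "\<And>i. schwartz (f $ i)"
  shows "class_vec (ncho_expr \<alpha> \<beta> f) $ 1 = \<alpha> *\<^sub>R abs_L2 (osc (f $ 1)) - abs_L2 (dil (f $ 2))"
    and "class_vec (ncho_expr \<alpha> \<beta> f) $ 2 = \<beta> *\<^sub>R abs_L2 (osc (f $ 2)) + abs_L2 (dil (f $ 1))"
proof -
  have s: "square_integrable (osc (f $ i))" "square_integrable (dil (f $ i))" for i
    using assms rapidly_decreasing_osc rapidly_decreasing_dil rapidly_decreasing_square_integrable by blast+
  show "class_vec (ncho_expr \<alpha> \<beta> f) $ 1 = \<alpha> *\<^sub>R abs_L2 (osc (f $ 1)) - abs_L2 (dil (f $ 2))"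
    by (simp add: class_vec_def ncho_expr_1 s abs_L2_scaleR abs_L2_diff square_integrable_scaleR
        del: complex_scaleR)
  show "class_vec (ncho_expr \<alpha> \<beta> f) $ 2 = \<beta> *\<^sub>R abs_L2 (osc (f $ 2)) + abs_L2 (dil (f $ 1))"
    by (simp add: class_vec_def ncho_expr_2 s abs_L2_scaleR abs_L2_add square_integrable_scaleR
        del: complex_scaleR)
qed

text \<open>Both sides are continuous in (u, w), so the identities pass from Schwartz functions to
  the closure. The dilation terms have the opposite sign to \<open>ncho_expr\<close> by
  antisymmetry.\<close>

lemma gpair_ncho:
  assumes "(u, w) \<in> ncho \<alpha> \<beta>"
  shows "gpair p (w $ 1) = \<alpha> * gpair (osc_poly p) (u $ 1) + gpair (dil_poly p) (u $ 2)"
    and "gpair p (w $ 2) = \<beta> * gpair (osc_poly p) (u $ 2) - gpair (dil_poly p) (u $ 1)"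
proof -
  define S :: "((L2 ^ 2) \<times> (L2 ^ 2)) set" where "S = {z. gpair p (snd z $ 1) = \<alpha> * gpair (osc_poly p) (fst z $ 1) + gpair (dil_poly p) (fst z $ 2)
    \<and> gpair p (snd z $ 2) = \<beta> * gpair (osc_poly p) (fst z $ 2) - gpair (dil_poly p) (fst z $ 1)}"
  have "closed S"
    unfolding S_def
    by (intro closed_Collect_conj closed_Collect_eq continuous_intros continuous_on_gpair)
  moreover have "ncho_schwartz \<alpha> \<beta> \<subseteq> S"
  proof
    fix z assume "z \<in> ncho_schwartz \<alpha> \<beta>"
    then obtain f where z: "z = (class_vec f, class_vec (ncho_expr \<alpha> \<beta> f))"
      and f: "\<And>i. schwartz (f $ i)"
      by (auto simp: ncho_schwartz_def)
    show "z \<in> S"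
      unfolding z S_def
      by (simp add: class_vec_ncho_expr[OF f] gpair_diff gpair_add gpair_scaleR gpair_osc gpair_dil f)
        (simp add: class_vec_def)
  qed
  ultimately have "ncho \<alpha> \<beta> \<subseteq> S"
    unfolding ncho_def by (intro closure_minimal)
  with assms have "(u, w) \<in> S" by blast
  then show "gpair p (w $ 1) = \<alpha> * gpair (osc_poly p) (u $ 1) + gpair (dil_poly p) (u $ 2)"
    "gpair p (w $ 2) = \<beta> * gpair (osc_poly p) (u $ 2) - gpair (dil_poly p) (u $ 1)"
    by (auto simp: S_def)
qed

text \<open>The truncated differences \<open>n - 1\<close> and \<open>n - 2\<close> are harmless: where they truncate, the factor
  \<open>n * (n - 1)\<close> is \<open>0\<close>.\<close>

definition coef_rec :: "real \<Rightarrow> real \<Rightarrow> real \<Rightarrow> L2 ^ 2 \<Rightarrow> bool" where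
  "coef_rec \<alpha> \<beta> E u \<longleftrightarrow> (\<forall>n.
     gpair (hermite (n + 2)) (u $ 2) = 4 * (of_real (\<alpha> * (real n + 1/2) - E) * gpair (hermite n) (u $ 1) +
        of_real (real n * real (n - 1)) * gpair (hermite (n - 2)) (u $ 2)) \<and>
     gpair (hermite (n + 2)) (u $ 1) = 4 * (of_real (real n * real (n - 1)) * gpair (hermite (n - 2)) (u $ 1) -
        of_real (\<beta> * (real n + 1/2) - E) * gpair (hermite n) (u $ 2)))"

lemma eigenspace_coef_rec:
  assumes "u \<in> eigenspace (ncho \<alpha> \<beta>) (of_real E)"
  shows "coef_rec \<alpha> \<beta> E u"
  unfolding coef_rec_def
proof (intro allI conjI)
  fix n
  have "(u, scaleC_vec (of_real E) u) \<in> ncho \<alpha> \<beta>"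
    using assms by (simp add: eigenspace_def)
  note h = gpair_ncho[OF this, of "hermite n", unfolded osc_hermite dil_hermite gpair_poly_smult gpair_poly_diff]
  have *: "Z = 4 * (of_real (c - E) * X + Y)" if "of_real E * X = of_real c * X + Y - Z / 4"
    for c and X Y Z :: complex
  proof -
    have "4 * (of_real (c - E) * X + Y) = 4 * (of_real c * X + Y) - 4 * (of_real E * X)"
      by (simp add: algebra_simps)
    then show ?thesis unfolding that by simp
  qed
  show "gpair (hermite (n + 2)) (u $ 2) = 4 * (of_real (\<alpha> * (real n + 1/2) - E) * gpair (hermite n) (u $ 1) +
        of_real (real n * real (n - 1)) * gpair (hermite (n - 2)) (u $ 2))"
    by (rule *) (use h(1) in \<open>simp add: scaleC_vec_def gpair_scaleC del: hermite.simps\<close>)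
  have "- gpair (hermite (n + 2)) (u $ 1) = 4 * (of_real (\<beta> * (real n + 1/2) - E) * gpair (hermite n) (u $ 2) +
        of_real (- (real n * real (n - 1))) * gpair (hermite (n - 2)) (u $ 1))"
    by (rule *) (use h(2) in \<open>simp add: scaleC_vec_def gpair_scaleC del: hermite.simps\<close>)
  then show "gpair (hermite (n + 2)) (u $ 1) = 4 * (of_real (real n * real (n - 1)) * gpair (hermite (n - 2)) (u $ 1) -
        of_real (\<beta> * (real n + 1/2) - E) * gpair (hermite n) (u $ 2))"
    unfolding neg_eq_iff_add_eq_0 by (simp add: add_eq_0_iff algebra_simps del: hermite.simps)
qed

text \<open>\<open>r\<close> is a parity class. Since r (r - 1) = 0 for r < 2, the recurrence refers
  to nothing below index \<open>r\<close>, so the first pair of coefficients generates the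
  class.\<close>

lemma coef_rec_vanish:
  assumes "coef_rec \<alpha> \<beta> E u" "r < 2"
    and "gpair (hermite r) (u $ 1) = 0" "gpair (hermite r) (u $ 2) = 0"
  shows "gpair (hermite (2 * k + r)) (u $ 1) = 0 \<and> gpair (hermite (2 * k + r)) (u $ 2) = 0"
proof (induction k rule: less_induct)
  case (less k)
  show ?case
  proof (cases k)
    case (Suc j)
    define n where "n = 2 * j + r"
    have n: "2 * k + r = n + 2" by (simp add: Suc n_def)
    have a: "gpair (hermite n) (u $ 1) = 0" "gpair (hermite n) (u $ 2) = 0"
      using less.IH[of j] by (simp_all add: Suc n_def)
    have "real n * real (n - 1) = 0 \<or> gpair (hermite (n - 2)) (u $ 1) = 0 \<and> gpair (hermite (n - 2)) (u $ 2) = 0"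
    proof (cases j)
      case 0
      then show ?thesis using assms(2) by (auto simp: n_def less_2_cases_iff)
    next
      case (Suc i)
      then show ?thesis using less.IH[of i] \<open>k = Suc j\<close> by (simp add: n_def)
    qed
    then show ?thesis
      using assms(1)[unfolded coef_rec_def, rule_format, of n] a
      unfolding n by auto
  qed (use assms in simp)
qed

text \<open>\<open>W\<close> outgrows \<open>N\<close> by the factor \<open>5/4\<close> in each step.\<close>

lemma growth_bounded_zero:
  fixes W N :: "nat \<Rightarrow> real"
  assumes W: "\<And>k. W k \<ge> 0" and N: "\<And>k. N k > 0"
    and rec: "\<And>k. W (Suc k) \<ge> 4 * (2 * (2 * k + 1) * W k - (2 * k + 1) * (2 * k) * W (k - 1))"
    and step: "\<And>k. N (Suc k) \<le> 2 * (2 * k + 3) * N k"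
    and bound: "\<And>k. W k \<le> C * N k"
  shows "W 0 = 0"
proof (rule ccontr)
  assume "W 0 \<noteq> 0"
  then have W0: "W 0 > 0" using W[of 0] by simp
  \<comment> \<open>Any factor above 2 beats \<open>step\<close>, and the base case
    \<open>W 1 \<ge> 8 * W 0\<close> admits at most 8/3; 5/2 lies between and reproduces itself in
    the induction.\<close>
  have inc: "W (Suc k) \<ge> 5/2 * (2 * k + 3) * W k" for k
  proof (induction k)
    case 0
    show ?case using rec[of 0] W0 by simp
  next
    case (Suc k)
    define m where "m = real k"
    have m: "m \<ge> 0" by (simp add: m_def)
    have "W (Suc (Suc k)) \<ge> 4 * (2 * (2 * m + 3) * W (Suc k) - (2 * m + 3) * (2 * m + 2) * W k)"
      using rec[of "Suc k"] by (simp add: m_def algebra_simps)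
    moreover have "(2 * m + 2) * ((2 * m + 3) * W k) \<le> (2 * m + 2) * (2/5 * W (Suc k))"
      using Suc.IH m by (intro mult_left_mono) (auto simp: m_def algebra_simps)
    moreover have "4 * (2 * (2 * m + 3) * W (Suc k) - (2 * m + 3) * (2 * m + 2) * W k) =
        8 * ((2 * m + 3) * W (Suc k)) - 4 * ((2 * m + 2) * ((2 * m + 3) * W k))"
      by (simp add: algebra_simps)
    ultimately have "W (Suc (Suc k)) \<ge> 8 * ((2 * m + 3) * W (Suc k)) - 4 * ((2 * m + 2) * (2/5 * W (Suc k)))"
      by linarith
    then have "W (Suc (Suc k)) \<ge> (8 * (2 * m + 3) - 8/5 * (2 * m + 2)) * W (Suc k)"
      by (simp add: algebra_simps)
    moreover have "5/2 * (2 * m + 5) * W (Suc k) \<le> (8 * (2 * m + 3) - 8/5 * (2 * m + 2)) * W (Suc k)"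
      using m by (intro mult_right_mono W) (simp add: field_simps)
    ultimately show ?case by (simp add: m_def algebra_simps)
  qed
  have "(5/4) ^ k * N k * W 0 \<le> W k * N 0" for k
  proof (induction k)
    case (Suc k)
    have "(5/4) ^ Suc k * N (Suc k) * W 0 \<le> (5/4) ^ Suc k * (2 * (2 * k + 3) * N k) * W 0"
      using W0 step[of k] by (intro mult_left_mono mult_right_mono) auto
    also have "\<dots> = 5/2 * (2 * k + 3) * ((5/4) ^ k * N k * W 0)" by simp
    also have "\<dots> \<le> 5/2 * (2 * k + 3) * (W k * N 0)"
      using Suc.IH by (intro mult_left_mono) auto
    also have "\<dots> \<le> W (Suc k) * N 0"
      using inc[of k] N[of 0] by (simp flip: mult.assoc)
    finally show ?case .
  qed (simp add: mult.commute)
  moreover have "W k * N 0 \<le> C * N k * N 0" for k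
    using bound[of k] N[of 0] by (intro mult_right_mono) auto
  ultimately have "(5/4) ^ k * N k * W 0 \<le> C * N k * N 0" for k
    using order_trans by blast
  then have "N k * ((5/4) ^ k * W 0) \<le> N k * (C * N 0)" for k
    by (metis mult.assoc mult.commute)
  then have le: "(5/4) ^ k * W 0 \<le> C * N 0" for k
    using mult_left_le_imp_le N by blast
  obtain k where "(5/4 :: real) ^ k > C * N 0 / W 0"
    using real_arch_pow[of "5/4" "C * N 0 / W 0"] by fastforce
  then have "(5/4) ^ k * W 0 > C * N 0"
    using W0 by (simp add: field_simps)
  with le[of k] show False by simp
qed

text \<open>The recurrences link index k of one component to indices k - 1 and k + 1 of the other,
  so a sector is the zigzag X 0, Y 1, X 2, ... followed by \<open>W\<close>. At k = 0 the term with
  \<open>k - 1\<close> has coefficient 0.\<close>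

lemma alternating_growth_bounded_zero:
  fixes X Y :: "nat \<Rightarrow> complex" and N :: "nat \<Rightarrow> real"
  assumes N: "\<And>k. N k > 0"
    and recX: "\<And>k. norm (Y (Suc k)) \<ge> 4 * (2 * (2 * k + 1) * norm (X k) - (2 * k + 1) * (2 * k) * norm (Y (k - 1)))"
    and recY: "\<And>k. norm (X (Suc k)) \<ge> 4 * (2 * (2 * k + 1) * norm (Y k) - (2 * k + 1) * (2 * k) * norm (X (k - 1)))"
    and step: "\<And>k. N (Suc k) \<le> 2 * (2 * k + 3) * N k"
    and bound: "\<And>k. norm (X k) \<le> C * N k" "\<And>k. norm (Y k) \<le> C * N k"
  shows "X 0 = 0"
proof -
  define W where "W k = norm (if even k then X k else Y k)" for k
  have "W 0 = 0"
  proof (rule growth_bounded_zero[where N = N])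
    show "W (Suc k) \<ge> 4 * (2 * (2 * k + 1) * W k - (2 * k + 1) * (2 * k) * W (k - 1))" for k
      using recX[of k] recY[of k] by (cases k) (auto simp: W_def)
  qed (use N step bound in \<open>auto simp: W_def\<close>)
  then show ?thesis by (simp add: W_def)
qed

text \<open>The disjunction covers the different signs in the two lines of \<open>coef_rec\<close>.
  The bound on E cancels the zero-point term g/2 and leaves a diagonal coefficient of at least g n
  \<ge> 2 n.\<close>

lemma norm_linear_recurrence_ge:
  fixes X Y Z :: complex and g n :: real
  assumes Z: "Z = 4 * (of_real (g * (n + 1/2) - E) * X + n * (n - 1) * Y) \<or>
        Z = 4 * (n * (n - 1) * Y - of_real (g * (n + 1/2) - E) * X)"
    and g: "g > 2" "E \<le> g / 2" and n: "n \<ge> 1"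
  shows "norm Z \<ge> 4 * (2 * n * norm X - n * (n - 1) * norm Y)"
proof -
  have "norm Z \<ge> 4 * (norm (of_real (g * (n + 1/2) - E) * X) - norm (n * (n - 1) * Y))"
    using Z
  proof
    assume Z: "Z = 4 * (of_real (g * (n + 1/2) - E) * X + n * (n - 1) * Y)"
    show ?thesis
      unfolding Z norm_mult[of 4]
      using norm_diff_ineq[of "of_real (g * (n + 1/2) - E) * X" "n * (n - 1) * Y"] by simp
  next
    assume Z: "Z = 4 * (n * (n - 1) * Y - of_real (g * (n + 1/2) - E) * X)"
    show ?thesis
      unfolding Z norm_mult[of 4] norm_minus_commute[of "n * (n - 1) * Y"]
      using norm_triangle_ineq2[of "of_real (g * (n + 1/2) - E) * X" "n * (n - 1) * Y"] by simp
  qed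
  moreover have "norm (of_real (g * (n + 1/2) - E) * X) \<ge> 2 * n * norm X"
  proof -
    have "g * (n + 1/2) - E \<ge> g * n" using g by (simp add: algebra_simps)
    moreover have "g * n \<ge> 2 * n" using g n by (intro mult_right_mono) auto
    ultimately have "\<bar>g * (n + 1/2) - E\<bar> \<ge> 2 * n" by linarith
    then show ?thesis unfolding norm_mult norm_of_real by (intro mult_right_mono) auto
  qed
  moreover have "norm (n * (n - 1) * Y) = n * (n - 1) * norm Y"
  proof -
    have "norm (complex_of_real (n * (n - 1)) * Y) = n * (n - 1) * norm Y"
      unfolding norm_mult norm_of_real using n by simp
    then show ?thesis by simp
  qed
  ultimately show ?thesis by simp
qed

lemma coef_rec_odd:
  assumes rec: "coef_rec \<alpha> \<beta> E u" and ab: "\<alpha> > 2" "\<beta> > 2" and E: "E \<le> \<alpha> / 2" "E \<le> \<beta> / 2"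
  shows "gpair (hermite 1) (u $ 1) = 0" "gpair (hermite 1) (u $ 2) = 0"
proof -
  define X Y N where "X k = gpair (hermite (2 * k + 1)) (u $ 1)" and "Y k = gpair (hermite (2 * k + 1)) (u $ 2)"
    and "N k = norm (hermite_fun (2 * k + 1))" for k :: nat
  have N: "N k > 0" for k unfolding N_def by (rule norm_hermite_fun_pos)
  have step: "N (Suc k) \<le> 2 * (2 * k + 3) * N k" for k
    using norm_hermite_fun_step[of "2 * k + 1"] by (simp add: N_def algebra_simps numeral_3_eq_3)
  have bound: "norm (X k) \<le> (2 * (norm (u $ 1) + norm (u $ 2))) * N k"
     "norm (Y k) \<le> (2 * (norm (u $ 1) + norm (u $ 2))) * N k" for k
  proof -
    have *: "2 * (norm (u $ i) * N k) \<le> (2 * (norm (u $ 1) + norm (u $ 2))) * N k" if "i = 1 \<or> i = 2" for i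
      using N[of k] that by (auto simp: algebra_simps)
    have "norm (X k) \<le> 2 * (norm (u $ 1) * N k)" "norm (Y k) \<le> 2 * (norm (u $ 2) * N k)"
      unfolding X_def Y_def N_def hermite_fun_def by (rule norm_gpair_le)+
    then show "norm (X k) \<le> (2 * (norm (u $ 1) + norm (u $ 2))) * N k"
      "norm (Y k) \<le> (2 * (norm (u $ 1) + norm (u $ 2))) * N k"
      using *[OF disjI1[OF refl]] *[OF disjI2[OF refl]] by linarith+
  qed
  have r: "Y (Suc k) = 4 * (of_real (\<alpha> * ((2 * real k + 1) + 1/2) - E) * X k +
        (2 * real k + 1) * ((2 * real k + 1) - 1) * Y (k - 1))"
    "X (Suc k) = 4 * ((2 * real k + 1) * ((2 * real k + 1) - 1) * X (k - 1) -
        of_real (\<beta> * ((2 * real k + 1) + 1/2) - E) * Y k)" for k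
  proof -
    have c: "real (2 * k + 1) = 2 * real k + 1" "real (2 * k + 1 - 1) = (2 * real k + 1) - 1"
      "2 * k + 1 + 2 = 2 * Suc k + 1" by simp_all
    have "k = 0 \<or> 2 * k + 1 - 2 = 2 * (k - 1) + 1" by linarith
    then show "Y (Suc k) = 4 * (of_real (\<alpha> * ((2 * real k + 1) + 1/2) - E) * X k +
          (2 * real k + 1) * ((2 * real k + 1) - 1) * Y (k - 1))"
      "X (Suc k) = 4 * ((2 * real k + 1) * ((2 * real k + 1) - 1) * X (k - 1) -
          of_real (\<beta> * ((2 * real k + 1) + 1/2) - E) * Y k)"
      using rec[unfolded coef_rec_def, rule_format, of "2 * k + 1", unfolded c]
      unfolding X_def Y_def by (elim disjE; simp del: hermite.simps)+
  qed
  have recs: "norm (Y (Suc k)) \<ge> 4 * (2 * (2 * k + 1) * norm (X k) - (2 * k + 1) * (2 * k) * norm (Y (k - 1)))"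
    "norm (X (Suc k)) \<ge> 4 * (2 * (2 * k + 1) * norm (Y k) - (2 * k + 1) * (2 * k) * norm (X (k - 1)))" for k
    using norm_linear_recurrence_ge[OF disjI1[OF r(1)] ab(1) E(1)]
      norm_linear_recurrence_ge[OF disjI2[OF r(2)] ab(2) E(2)] by simp_all
  show "gpair (hermite 1) (u $ 1) = 0"
    using alternating_growth_bounded_zero[where X = X and Y = Y and N = N, OF N recs step bound] by (simp add: X_def)
  \<comment> \<open>Exchanging \<open>X\<close> and \<open>Y\<close> treats the odd sector that
    starts in the second component.\<close>
  show "gpair (hermite 1) (u $ 2) = 0"
    using alternating_growth_bounded_zero[where X = Y and Y = X and N = N, OF N recs(2,1) step bound(2,1)] by (simp add: Y_def)
qed

section \<open>Completeness of the Hermite functions\<close>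

text \<open>The positive and the negative part of \<open>h\<close> are, up to the same constant, probability densities with the
  same characteristic function.\<close>

lemma integral_iexp_eq_0_imp_AE_0:
  fixes h :: "real \<Rightarrow> real"
  assumes h: "integrable lborel h"
    and z: "\<And>t. (LINT x|lborel. of_real (h x) * iexp (t * x)) = 0"
  shows "AE x in lborel. h x = 0"
proof -
  have [measurable]: "h \<in> borel_measurable borel" using h by simp
  define P N where "P x = max 0 (h x)" and "N x = max 0 (- h x)" for x
  have [measurable]: "P \<in> borel_measurable borel" "N \<in> borel_measurable borel"
    unfolding P_def N_def by measurable
  have i: "integrable lborel P" "integrable lborel N"
    by (rule Bochner_Integration.integrable_bound[OF h]; simp add: P_def N_def)+
  have PN: "h x = P x - N x" "P x \<ge> 0" "N x \<ge> 0" for x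
    by (simp_all add: P_def N_def)
  have ie: "integrable lborel (\<lambda>x. P x *\<^sub>R iexp (t * x))" "integrable lborel (\<lambda>x. N x *\<^sub>R iexp (t * x))" for t
    by (rule Bochner_Integration.integrable_bound[OF i(1)], simp_all del: complex_scaleR)
      (rule Bochner_Integration.integrable_bound[OF i(2)], simp_all del: complex_scaleR)
  have eq: "(LINT x|lborel. P x *\<^sub>R iexp (t * x)) = (LINT x|lborel. N x *\<^sub>R iexp (t * x))" for t
  proof -
    have "(LINT x|lborel. P x *\<^sub>R iexp (t * x)) - (LINT x|lborel. N x *\<^sub>R iexp (t * x))
        = (LINT x|lborel. of_real (h x) * iexp (t * x))"
      unfolding Bochner_Integration.integral_diff[OF ie, symmetric]
      by (intro Bochner_Integration.integral_cong) (simp_all add: PN(1) scaleR_conv_of_real left_diff_distrib)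
    then show ?thesis unfolding z by (simp only: right_minus_eq)
  qed
  define c where "c = (LINT x|lborel. P x)"
  have c': "c = (LINT x|lborel. N x)"
  proof -
    have "complex_of_real c = complex_of_real (LINT x|lborel. N x)"
      using eq[of 0] by (simp add: c_def scaleR_conv_of_real)
    then show ?thesis by simp
  qed
  show ?thesis
  proof (cases "c = 0")
    case True
    have "AE x in lborel. P x = 0" "AE x in lborel. N x = 0"
      using True c' i by (auto simp: c_def PN integral_nonneg_eq_0_iff_AE[symmetric])
    then show ?thesis by eventually_elim (simp add: PN(1))
  next
    case False
    moreover have "c \<ge> 0" unfolding c_def by (simp add: PN)
    ultimately have c: "c > 0" by simp
    have dist: "real_distribution (density lborel (\<lambda>x. ennreal (F x / c)))"
      if F: "integrable lborel F" "\<And>x. F x \<ge> 0" "c = (LINT x|lborel. F x)" for F :: "real \<Rightarrow> real"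
    proof -
      have [measurable]: "F \<in> borel_measurable borel" using F by simp
      have "(\<integral>\<^sup>+x. ennreal (F x / c) \<partial>lborel) = ennreal (LINT x|lborel. F x / c)"
        using F c by (intro nn_integral_eq_integral) auto
      also have "\<dots> = 1" using F(3) c by simp
      finally show ?thesis
        by (intro real_distribution.intro prob_spaceI real_distribution_axioms.intro)
          (simp_all add: emeasure_density)
    qed
    have ch: "char (density lborel (\<lambda>x. ennreal (F x / c))) t = (LINT x|lborel. F x *\<^sub>R iexp (t * x)) / c"
      if F: "integrable lborel F" "\<And>x. F x \<ge> 0" for F :: "real \<Rightarrow> real" and t
    proof -
      have [measurable]: "F \<in> borel_measurable borel" using F by simp
      have "char (density lborel (\<lambda>x. ennreal (F x / c))) t = (LINT x|lborel. (F x / c) *\<^sub>R iexp (t * x))"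
        unfolding char_def by (subst integral_density) (use F c in auto)
      also have "\<dots> = (LINT x|lborel. (F x *\<^sub>R iexp (t * x)) / c)"
        by (simp add: scaleR_conv_of_real)
      finally show ?thesis by simp
    qed
    have "density lborel (\<lambda>x. ennreal (P x / c)) = density lborel (\<lambda>x. ennreal (N x / c))"
      by (intro Levy_uniqueness dist i PN c' c_def ext) (simp only: ch[OF i(1) PN(2)] ch[OF i(2) PN(3)] eq)
    then have "AE x in lborel. ennreal (P x / c) = ennreal (N x / c)"
      by (intro sigma_finite_measure.density_unique[OF sigma_finite_lborel]) simp_all
    then show ?thesis
      by eventually_elim (use c in \<open>simp add: PN divide_simps\<close>)
  qed
qed

text \<open>The transform of the conjugate at t is the conjugate of the transform at -t, so the
  transforms of Re g and Im g vanish as well.\<close>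

lemma complex_integral_iexp_eq_0_imp_AE_0:
  fixes g :: "real \<Rightarrow> complex"
  assumes g: "integrable lborel g"
    and z: "\<And>t. (LINT x|lborel. g x * iexp (t * x)) = 0"
  shows "AE x in lborel. g x = 0"
proof -
  have ie: "integrable lborel (\<lambda>x. g x * iexp (t * x))" for t
    by (rule Bochner_Integration.integrable_bound[OF g]) (use g in \<open>auto simp: norm_mult\<close>)
  have zc: "(LINT x|lborel. cnj (g x) * iexp (t * x)) = 0" for t
  proof -
    have "(LINT x|lborel. cnj (g x) * iexp (t * x)) = cnj (LINT x|lborel. g x * iexp ((-t) * x))"
      unfolding Bochner_Integration.integral_cnj[symmetric]
      by (intro Bochner_Integration.integral_cong) (simp_all add: exp_cnj)
    then show ?thesis by (simp only: z) simp
  qed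
  have [measurable]: "(\<lambda>x. cnj (g x)) \<in> borel_measurable borel"
    using borel_measurable_integrable[OF integrable_cnj[OF g]] by simp
  have iec: "integrable lborel (\<lambda>x. cnj (g x) * iexp (t * x))" for t
    by (rule Bochner_Integration.integrable_bound[OF g]) (use g in \<open>auto simp: norm_mult\<close>)
  have "(LINT x|lborel. of_real (Re (g x)) * iexp (t * x)) = 0" for t
  proof -
    have *: "of_real (Re w) * v = (1/2) * (w * v + cnj w * v)" for w v
      by (simp add: complex_eq_iff)
    have "(LINT x|lborel. of_real (Re (g x)) * iexp (t * x)) =
        (LINT x|lborel. (1/2) * (g x * iexp (t * x) + cnj (g x) * iexp (t * x)))"
      by (rule Bochner_Integration.integral_cong[OF refl *])
    also have "\<dots> = (1/2) * ((LINT x|lborel. g x * iexp (t * x)) + (LINT x|lborel. cnj (g x) * iexp (t * x)))"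
      by (simp only: integral_mult_right_zero Bochner_Integration.integral_add[OF ie iec])
    finally show ?thesis unfolding z zc by simp
  qed
  then have re: "AE x in lborel. Re (g x) = 0"
    using g by (intro integral_iexp_eq_0_imp_AE_0) auto
  have "(LINT x|lborel. of_real (Im (g x)) * iexp (t * x)) = 0" for t
  proof -
    have *: "of_real (Im w) * v = (1/2) * (- \<i>) * (w * v - cnj w * v)" for w v
      by (simp add: complex_eq_iff)
    have "(LINT x|lborel. of_real (Im (g x)) * iexp (t * x)) =
        (LINT x|lborel. (1/2) * (- \<i>) * (g x * iexp (t * x) - cnj (g x) * iexp (t * x)))"
      by (rule Bochner_Integration.integral_cong[OF refl *])
    also have "\<dots> = (1/2) * (- \<i>) * ((LINT x|lborel. g x * iexp (t * x)) - (LINT x|lborel. cnj (g x) * iexp (t * x)))"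
      by (simp only: integral_mult_right_zero Bochner_Integration.integral_diff[OF ie iec])
    finally show ?thesis unfolding z zc by simp
  qed
  then have im: "AE x in lborel. Im (g x) = 0"
    using g by (intro integral_iexp_eq_0_imp_AE_0) auto
  from re im show ?thesis by eventually_elim (simp add: complex_eq_iff)
qed

text \<open>Dominates the exponential series times the Gaussian in the completeness proof.\<close>

lemma square_integrable_exp_gaussian:
  "square_integrable (\<lambda>x. of_real (exp (\<bar>t * x\<bar> - x\<^sup>2 / 2)))"
  unfolding square_integrable_def
proof
  have i: "integrable lborel (\<lambda>x. exp (2 * t\<^sup>2) * norm (gpoly 1 x))"
    by (intro integrable_mult_right integrable_norm rapidly_decreasing_integrable rapidly_decreasing_gpoly)
  have "(exp (\<bar>t * x\<bar> - x\<^sup>2 / 2))\<^sup>2 \<le> exp (2 * t\<^sup>2) * norm (gpoly 1 x)" for x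
  proof -
    have "2 * \<bar>t * x\<bar> - x\<^sup>2 \<le> 2 * t\<^sup>2 - x\<^sup>2 / 2"
      using zero_le_power2[of "2 * \<bar>t\<bar> - \<bar>x\<bar>"] by (simp add: power2_diff abs_mult)
    then show ?thesis
      by (simp add: gpoly_def norm_mult flip: exp_add exp_double)
  qed
  then show "integrable lborel (\<lambda>x. (norm (complex_of_real (exp (\<bar>t * x\<bar> - x\<^sup>2 / 2))))\<^sup>2)"
    by (intro Bochner_Integration.integrable_bound[OF i]) auto
qed measurable

lemma gpair_hermite_eq_0_imp_gpair_monom:
  assumes "\<And>n. gpair (hermite n) u = 0"
  shows "gpair (monom 1 m) u = 0"
proof -
  \<comment> \<open>The factor \<open>hermite n\<close> carries the induction: x H_n = H_(n+1)/2 + n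
    H_(n-1) trades one power of x for a change of n.\<close>
  have "gpair (monom 1 m * hermite n) u = 0" for n
  proof (induction m arbitrary: n)
    case 0
    then show ?case using assms by (simp add: monom_0)
  next
    case (Suc m)
    have "monom 1 (Suc m) * hermite n = smult (1/2) (monom 1 m * hermite (Suc n)) +
        smult n (monom 1 m * hermite (n - 1))"
      by (intro poly_ext) (simp add: poly_monom pderiv_hermite algebra_simps)
    then show ?case
      by (simp only: gpair_poly_add gpair_poly_smult Suc.IH) simp
  qed
  from this[of 0] show ?thesis by simp
qed

text \<open>All moments of \<open>f\<close> times the Gaussian vanish. Integrating the power series
  of iexp (t x) termwise makes its Fourier transform vanish, and uniqueness gives f = 0 almost
  everywhere.\<close>

lemma hermite_complete:
  assumes "\<And>n. gpair (hermite n) u = 0"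
  shows "u = 0"
proof -
  obtain f where f: "square_integrable f" and u: "u = abs_L2 f" by (rule L2_exhaust)
  have [measurable]: "f \<in> borel_measurable borel" using f by (simp add: square_integrable_def)
  have mom: "(LINT x|lborel. f x * gpoly (monom 1 m) x) = 0" for m
    using gpair_hermite_eq_0_imp_gpair_monom[OF assms] by (simp add: u gpair_abs_L2 f)
  have imom: "integrable lborel (\<lambda>x. f x * gpoly (monom 1 m) x)" for m
    by (intro square_integrable_mult_integrable f square_integrable_gpoly)
  define g where "g x = f x * gpoly 1 x" for x
  have [measurable]: "g \<in> borel_measurable borel"
    unfolding g_def using rapidly_decreasing_measurable[OF rapidly_decreasing_gpoly] by measurable
  have "(LINT x|lborel. g x * iexp (t * x)) = 0" for t
  proof -
    define s where "s n x = (\<Sum>k<n. (\<i> * t) ^ k / fact k * (f x * gpoly (monom 1 k) x))" for n and x :: real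
    have s_eq: "s n x = g x * (\<Sum>k<n. (\<i> * complex_of_real (t * x)) ^ k /\<^sub>R fact k)" for n x
      unfolding s_def g_def sum_distrib_left
      by (intro sum.cong) (auto simp: gpoly_def poly_monom power_mult_distrib scaleR_conv_of_real field_simps)
    have "(\<lambda>n. LINT x|lborel. s n x) \<longlonglongrightarrow> (LINT x|lborel. g x * iexp (t * x))"
    proof (rule integral_dominated_convergence)
      show "integrable lborel (\<lambda>x. norm (f x * of_real (exp (\<bar>t * x\<bar> - x\<^sup>2 / 2))))"
        by (intro integrable_norm square_integrable_mult_integrable f square_integrable_exp_gaussian)
      show "AE x in lborel. (\<lambda>n. s n x) \<longlonglongrightarrow> g x * iexp (t * x)"
      proof (rule AE_I2)
        fix x
        show "(\<lambda>n. s n x) \<longlonglongrightarrow> g x * iexp (t * x)"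
          unfolding s_eq using exp_converges[of "\<i> * complex_of_real (t * x)"]
          by (intro tendsto_mult_left) (simp add: sums_def)
      qed
      show "AE x in lborel. norm (s n x) \<le> norm (f x * of_real (exp (\<bar>t * x\<bar> - x\<^sup>2 / 2)))" for n
      proof (rule AE_I2)
        fix x
        have "norm (\<Sum>k<n. (\<i> * complex_of_real (t * x)) ^ k /\<^sub>R fact k) \<le>
            (\<Sum>k<n. \<bar>t * x\<bar> ^ k /\<^sub>R fact k)"
          by (intro sum_norm_le) (simp add: norm_mult norm_power norm_divide abs_mult)
        also have "\<dots> \<le> exp \<bar>t * x\<bar>"
          unfolding exp_def by (intro sum_le_suminf summable_exp_generic) auto
        finally have "norm (s n x) \<le> norm (g x) * exp \<bar>t * x\<bar>"
          unfolding s_eq norm_mult by (rule mult_left_mono) simp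
        also have "\<dots> = norm (f x * of_real (exp (\<bar>t * x\<bar> - x\<^sup>2 / 2)))"
        proof -
          have e: "exp (\<bar>t * x\<bar> - x\<^sup>2 / 2) = exp (- x\<^sup>2 / 2) * exp \<bar>t * x\<bar>"
            by (simp flip: exp_add)
          show ?thesis unfolding e by (simp add: g_def gpoly_def norm_mult)
        qed
        finally show "norm (s n x) \<le> norm (f x * of_real (exp (\<bar>t * x\<bar> - x\<^sup>2 / 2)))" .
      qed
    qed (use rapidly_decreasing_measurable[OF rapidly_decreasing_gpoly] in \<open>auto simp: s_def\<close>)
    moreover have "(LINT x|lborel. s n x) = 0" for n
      unfolding s_def by (simp add: imom mom)
    ultimately show ?thesis by (simp add: LIMSEQ_const_iff)
  qed
  moreover have "integrable lborel g"
    unfolding g_def by (intro square_integrable_mult_integrable f square_integrable_gpoly)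
  ultimately have "AE x in lborel. g x = 0"
    by (intro complex_integral_iexp_eq_0_imp_AE_0)
  then have "AE x in lborel. f x = 0"
    by eventually_elim (simp add: g_def gpoly_def)
  then show ?thesis by (simp add: u abs_L2_eq_0_iff f)
qed

section \<open>Existence of a low eigenvalue\<close>

text \<open>For the Jacobi matrix with diagonal \<open>d\<close> and off-diagonal entries \<open>- 1/4\<close>, \<open>- 2 k (2 k - 1)\<close>, with
  \<open>a k = d (k + 1) - d 0\<close> and the eigenvalue \<open>d 0 - s 0 / 2\<close>, the number \<open>s k\<close> is \<open>4 (k + 1)\<close> times the ratio of the coefficients \<open>k + 1\<close> and \<open>k\<close>
  of the eigenvector. The right-hand sides of \<open>s k = (k + 1) / \<dots>\<close> form a contraction of
  \<open>{0..1/2}\<close>-valued sequences.\<close>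

lemma continued_fraction_solution_exists:
  fixes a b :: "nat \<Rightarrow> real"
  assumes a: "\<And>k. a k \<ge> 4 * real (Suc k)"
  obtains s :: "nat \<Rightarrow> real" where
    "\<And>k. s k \<in> {0..1/2}" "\<And>k. s k * (a k + s 0 / 2 - (real k + 3/2) * s (Suc k)) = real (Suc k)"
proof -
  define \<Phi> where "\<Phi> s k = real (Suc k) / (a k + s 0 / 2 - (real k + 3/2) * s (Suc k))" for s :: "nat \<Rightarrow> real" and k
  \<comment> \<open>The subtracted term is at most (k + 3/2)/2 \<le> k + 1, a quarter of the lower
    bound for \<open>a k\<close>.\<close>
  have den: "a k + s 0 / 2 - (real k + 3/2) * s (Suc k) \<ge> 3 * real (Suc k)"
    if "\<And>k. s k \<in> {0..1/2}" for s :: "nat \<Rightarrow> real" and k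
  proof -
    have "(real k + 3/2) * s (Suc k) \<le> (real k + 3/2) * (1/2)"
      using that[of "Suc k"] by (intro mult_left_mono) auto
    then show ?thesis
      using a[of k] that[of 0] of_nat_0_le_iff[of k, where 'a = real]
      unfolding atLeastAtMost_iff of_nat_Suc by (elim conjE) (simp add: algebra_simps)
  qed
  have range: "\<Phi> s k \<in> {0..1/2}" if "\<And>k. s k \<in> {0..1/2}" for s k
  proof -
    have *: "m / D \<in> {0..1/2}" if "D \<ge> 3 * m" "m > 0" for m D :: real
      using that by (auto simp: field_simps)
    show ?thesis unfolding \<Phi>_def by (rule *[OF den[OF that]]) simp
  qed
  \<comment> \<open>Denominators of size at least 3 m that differ by at most 2 m d give the factor
    2/9, rounded up to 1/2.\<close>
  have lip: "\<bar>\<Phi> s k - \<Phi> t k\<bar> \<le> 1/2 * d"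
    if s: "\<And>k. s k \<in> {0..1/2}" and t: "\<And>k. t k \<in> {0..1/2}" and d: "\<And>k. \<bar>s k - t k\<bar> \<le> d" for s t k d
  proof -
    define x y where "x = a k + s 0 / 2 - (real k + 3/2) * s (Suc k)"
      and "y = a k + t 0 / 2 - (real k + 3/2) * t (Suc k)"
    define m where "m = real (Suc k)"
    have m: "m \<ge> 1" by (simp add: m_def)
    have x: "x \<ge> 3 * m" and y: "y \<ge> 3 * m"
      unfolding x_def y_def m_def by (intro den s t)+
    have d0: "d \<ge> 0" using d[of 0] by linarith
    have "\<bar>x - y\<bar> \<le> \<bar>s 0 - t 0\<bar> / 2 + (m + 1/2) * \<bar>s (Suc k) - t (Suc k)\<bar>"
    proof -
      have "x - y = (s 0 - t 0) / 2 - (m + 1/2) * (s (Suc k) - t (Suc k))"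
        by (simp add: x_def y_def m_def algebra_simps diff_divide_distrib)
      then have "\<bar>x - y\<bar> \<le> \<bar>(s 0 - t 0) / 2\<bar> + \<bar>(m + 1/2) * (s (Suc k) - t (Suc k))\<bar>"
        by (simp only: abs_triangle_ineq4)
      also have "\<bar>(m + 1/2) * (s (Suc k) - t (Suc k))\<bar> = (m + 1/2) * \<bar>s (Suc k) - t (Suc k)\<bar>"
        using m by (simp add: abs_mult)
      finally show ?thesis by simp
    qed
    also have "\<dots> \<le> d / 2 + (m + 1/2) * d"
      using m by (intro add_mono divide_right_mono mult_left_mono d) auto
    also have "\<dots> \<le> 2 * m * d"
      using m d0 mult_right_mono[of 1 m d] by (simp add: algebra_simps)
    finally have xy: "\<bar>x - y\<bar> \<le> 2 * m * d" .
    have pos: "x > 0" "y > 0" using x y m by linarith+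
    have "\<Phi> s k = m / x" "\<Phi> t k = m / y"
      by (simp_all only: \<Phi>_def x_def y_def m_def)
    then have "\<Phi> s k - \<Phi> t k = m * (y - x) / (x * y)"
      using pos by (simp add: field_simps)
    then have "\<bar>\<Phi> s k - \<Phi> t k\<bar> = m * \<bar>x - y\<bar> / (x * y)"
      using pos m by (simp add: abs_mult abs_minus_commute)
    also have "\<dots> \<le> m * (2 * m * d) / ((3 * m) * (3 * m))"
      using xy x y m pos d0 by (intro frac_le mult_left_mono mult_mono) auto
    also have "\<dots> = 2/9 * d" using m by (simp add: field_simps)
    also have "\<dots> \<le> 1/2 * d" using d0 by simp
    finally show ?thesis .
  qed
  define z where "z n = (\<Phi> ^^ n) (\<lambda>_. 0)" for n
  have zr: "z n k \<in> {0..1/2}" for n k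
    by (induction n arbitrary: k) (simp_all add: z_def range del: atLeastAtMost_iff, simp)
  have zd: "\<bar>z (Suc n) k - z n k\<bar> \<le> (1/2) ^ n" for n k
  proof (induction n arbitrary: k)
    case 0
    show ?case using zr[of 1 k] zr[of 0 k] by (simp add: abs_le_iff)
  next
    case (Suc n)
    have "\<bar>\<Phi> (z (Suc n)) k - \<Phi> (z n) k\<bar> \<le> 1/2 * (1/2) ^ n"
      by (rule lip[OF zr zr Suc.IH])
    then show ?case by (simp add: z_def)
  qed
  \<comment> \<open>Convergence for each k separately is enough, because \<open>\<Phi> s k\<close>
    involves only \<open>s 0\<close> and \<open>s (Suc k)\<close>.\<close>
  have "\<exists>l. (\<lambda>n. z n k) \<longlonglongrightarrow> l" for k
  proof -
    have "summable (\<lambda>n. z (Suc n) k - z n k)"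
      by (rule summable_comparison_test'[of "\<lambda>n. (1/2) ^ n" 0])
        (use zd in \<open>auto intro: summable_geometric\<close>)
    then have "(\<lambda>n. (\<Sum>i<n. z (Suc i) k - z i k) + z 0 k) \<longlonglongrightarrow> (\<Sum>n. z (Suc n) k - z n k) + z 0 k"
      by (intro tendsto_add summable_LIMSEQ tendsto_const)
    then show ?thesis
      unfolding sum_lessThan_telescope[of "\<lambda>i. z i k"] by auto
  qed
  then obtain s where lim: "\<And>k. (\<lambda>n. z n k) \<longlonglongrightarrow> s k" by metis
  have s: "s k \<in> {0..1/2}" for k
    by (rule Lim_in_closed_set[OF closed_atLeastAtMost always_eventually _ lim]) (use zr in auto)
  have den': "a k + s 0 / 2 - (real k + 3/2) * s (Suc k) \<noteq> 0" for k
    using den[of s k] s by fastforce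
  have "s k = \<Phi> s k" for k
  proof (rule LIMSEQ_unique)
    show "(\<lambda>n. z (Suc n) k) \<longlonglongrightarrow> s k" using lim by (rule LIMSEQ_Suc)
    have "(\<lambda>n. \<Phi> (z n) k) \<longlonglongrightarrow> \<Phi> s k"
      unfolding \<Phi>_def using den' by (intro tendsto_intros lim) auto
    then show "(\<lambda>n. z (Suc n) k) \<longlonglongrightarrow> \<Phi> s k" by (simp add: z_def)
  qed
  then have "s k * (a k + s 0 / 2 - (real k + 3/2) * s (Suc k)) = real (Suc k)" for k
    unfolding \<Phi>_def using nonzero_eq_divide_eq[OF den'[of k], THEN iffD1] by blast
  with s show thesis by (rule that)
qed

text \<open>A Cauchy-Schwarz inequality with geometric weights, in a form that follows by induction from
  \<open>(x + y)\<^sup>2 \<le> 2 x\<^sup>2 + 2 y\<^sup>2\<close>.\<close>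

lemma norm_square_sum_le:
  fixes a :: "nat \<Rightarrow> 'a :: real_normed_vector"
  shows "2 ^ m * (norm (\<Sum>k<d. a (m + k)))\<^sup>2 \<le> 2 * (\<Sum>k<d. 2 ^ (m + k) * (norm (a (m + k)))\<^sup>2)"
proof (induction d arbitrary: m)
  case (Suc d)
  define A where "A = (\<Sum>k<d. a (Suc m + k))"
  have "(norm (a m + A))\<^sup>2 \<le> (norm (a m) + norm A)\<^sup>2"
    by (intro power_mono norm_triangle_ineq) auto
  also have "\<dots> \<le> 2 * (norm (a m))\<^sup>2 + 2 * (norm A)\<^sup>2"
    using zero_le_power2[of "norm (a m) - norm A"] by (simp add: power2_eq_square algebra_simps)
  finally have "2 ^ m * (norm (a m + A))\<^sup>2 \<le> 2 ^ m * (2 * (norm (a m))\<^sup>2 + 2 * (norm A)\<^sup>2)"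
    by (intro mult_left_mono) auto
  also have "\<dots> = 2 * (2 ^ m * (norm (a m))\<^sup>2) + 2 ^ Suc m * (norm A)\<^sup>2"
    by (simp add: algebra_simps)
  also have "\<dots> \<le> 2 * (2 ^ m * (norm (a m))\<^sup>2) + 2 * (\<Sum>k<d. 2 ^ (Suc m + k) * (norm (a (Suc m + k)))\<^sup>2)"
    unfolding A_def by (intro add_left_mono Suc.IH)
  finally show ?case
    unfolding sum.lessThan_Suc_shift by (simp add: A_def)
qed simp

section \<open>Geometrically bounded series in \<open>L2\<close>\<close>

lemma abs_L2_sum:
  fixes g :: "nat \<Rightarrow> real \<Rightarrow> complex"
  assumes "\<And>k. square_integrable (g k)"
  shows "square_integrable (\<lambda>x. \<Sum>k<m. g k x)" "(\<Sum>k<m. abs_L2 (g k)) = abs_L2 (\<lambda>x. \<Sum>k<m. g k x)"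
proof (induction m)
  case 0
  show "square_integrable (\<lambda>x. \<Sum>k<0. g k x)" by (simp add: square_integrable_zero)
  show "(\<Sum>k<0. abs_L2 (g k)) = abs_L2 (\<lambda>x. \<Sum>k<0. g k x)" by (simp add: zero_L2_def)
next
  case (Suc m)
  show "square_integrable (\<lambda>x. \<Sum>k<Suc m. g k x)"
    using square_integrable_add[OF Suc(1) assms] by simp
  show "(\<Sum>k<Suc m. abs_L2 (g k)) = abs_L2 (\<lambda>x. \<Sum>k<Suc m. g k x)"
    using abs_L2_add[OF Suc(1) assms] Suc(2) by simp
qed

lemma norm_abs_L2: "square_integrable f \<Longrightarrow> (norm (abs_L2 f))\<^sup>2 = (LINT x|lborel. (norm (f x))\<^sup>2)"
  by (simp add: power2_norm_eq_inner abs_L2_inner)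

text \<open>A Riesz-Fischer argument: the sum is taken pointwise almost everywhere. With the weights
  2^k the squares still have an integrable sum \<open>H\<close>, and the squared tail after m terms
  is at most 2 (1/2)^m \<open>H\<close>.\<close>

lemma summable_L2_geometric:
  fixes f :: "nat \<Rightarrow> L2"
  assumes f: "\<And>k. norm (f k) \<le> C * (1/2) ^ k"
  shows "summable f"
proof -
  have "\<exists>g. square_integrable g \<and> f k = abs_L2 g" for k
    using L2_exhaust[of "f k"] by blast
  then obtain g where g: "\<And>k. square_integrable (g k)" "\<And>k. f k = abs_L2 (g k)"
    by metis
  have [measurable]: "g k \<in> borel_measurable borel" for k
    using g(1) by (simp add: square_integrable_def)
  define G where "G k x = 2 ^ k * (norm (g k x))\<^sup>2" for k x
  have G0: "G k x \<ge> 0" for k x by (simp add: G_def)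
  have [measurable]: "G k \<in> borel_measurable borel" for k unfolding G_def by measurable
  have iG: "integrable lborel (G k)" for k
    using g(1)[of k] unfolding G_def square_integrable_def by (intro integrable_mult_right) auto
  have IG: "(LINT x|lborel. G k x) \<le> C\<^sup>2 * (1/2) ^ k" for k
  proof -
    have "(LINT x|lborel. G k x) = 2 ^ k * (norm (f k))\<^sup>2"
      by (simp add: G_def g(2) norm_abs_L2 g(1))
    also have "\<dots> \<le> 2 ^ k * (C * (1/2) ^ k)\<^sup>2"
      by (intro mult_left_mono power_mono f) auto
    also have "\<dots> = C\<^sup>2 * (2 ^ k * (1/2) ^ k) * (1/2) ^ k"
      by (simp add: power2_eq_square)
    finally show ?thesis by (simp add: power_one_over)
  qed
  have sIG: "summable (\<lambda>k. LINT x|lborel. G k x)"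
    by (rule summable_comparison_test'[of "\<lambda>k. C\<^sup>2 * (1/2) ^ k" 0])
      (use IG G0 in \<open>auto intro!: summable_mult summable_geometric\<close>)
  have sG: "AE x in lborel. summable (\<lambda>k. G k x)"
  proof -
    have "(\<integral>\<^sup>+x. (\<Sum>k. ennreal (G k x)) \<partial>lborel) = (\<Sum>k. ennreal (LINT x|lborel. G k x))"
      by (subst nn_integral_suminf) (use iG G0 in \<open>simp_all add: nn_integral_eq_integral\<close>)
    also have "\<dots> \<noteq> \<infinity>"
      using sIG G0 by (subst suminf_ennreal2) auto
    finally have "AE x in lborel. (\<Sum>k. ennreal (G k x)) \<noteq> \<infinity>"
      by (intro nn_integral_PInf_AE) measurable
    then show ?thesis
      by eventually_elim (auto intro!: summable_suminf_not_top G0)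
  qed
  define H where "H x = (\<Sum>k. G k x)" for x
  have iH: "integrable lborel H"
    unfolding H_def by (rule integrable_suminf) (use iG sG sIG G0 in auto)
  define h where "h x = (\<Sum>k. g k x)" for x
  have [measurable]: "h \<in> borel_measurable borel" unfolding h_def by measurable
  have bound: "AE x in lborel. (norm (h x - (\<Sum>k<m. g k x)))\<^sup>2 \<le> 2 * (1/2) ^ m * H x" for m
    using sG
  proof eventually_elim
    fix x assume s: "summable (\<lambda>k. G k x)"
    have A: "summable (\<lambda>k. 1/2 * ((1/2) ^ k + G k x))"
      by (intro summable_mult summable_add s summable_geometric) auto
    \<comment> \<open>The arithmetic-geometric mean inequality with weight 2^k provides a summable
      majorant.\<close>
    have B: "norm (g k x) \<le> 1/2 * ((1/2) ^ k + G k x)" for k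
    proof -
      have "0 \<le> (1/2) ^ k * (1 - 2 ^ k * norm (g k x))\<^sup>2" by simp
      also have "\<dots> = (1/2) ^ k - 2 * ((1/2) ^ k * 2 ^ k) * norm (g k x) + ((1/2) ^ k * 2 ^ k) * G k x"
        by (simp add: power2_eq_square algebra_simps G_def)
      finally show ?thesis by (simp add: power_one_over)
    qed
    have hermite_sign: "summable (\<lambda>k. g k x)"
      by (rule summable_comparison_test'[OF A]) (rule B)
    have "(\<lambda>d. \<Sum>k<d. g (m + k) x) \<longlonglongrightarrow> h x - (\<Sum>k<m. g k x)"
      using sums_split_initial_segment[OF summable_sums[OF hermite_sign], of m]
      by (simp add: sums_def h_def add.commute)
    then have A2: "(\<lambda>d. 2 ^ m * (norm (\<Sum>k<d. g (m + k) x))\<^sup>2) \<longlonglongrightarrow> 2 ^ m * (norm (h x - (\<Sum>k<m. g k x)))\<^sup>2"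
      by (intro tendsto_intros)
    have B2: "2 ^ m * (norm (\<Sum>k<d. g (m + k) x))\<^sup>2 \<le> 2 * H x" for d
    proof -
      have "2 ^ m * (norm (\<Sum>k<d. g (m + k) x))\<^sup>2 \<le> 2 * (\<Sum>k<d. G (m + k) x)"
        unfolding G_def by (rule norm_square_sum_le)
      also have "(\<Sum>k<d. G (m + k) x) = (\<Sum>k\<in>{m..<m+d}. G k x)"
        by (rule sum.reindex_bij_witness[of _ "\<lambda>k. k - m" "\<lambda>k. m + k"]) auto
      also have "\<dots> \<le> H x"
        unfolding H_def by (intro sum_le_suminf s) (auto simp: G0)
      finally show ?thesis by simp
    qed
    have "2 ^ m * (norm (h x - (\<Sum>k<m. g k x)))\<^sup>2 \<le> 2 * H x"
      by (rule LIMSEQ_le_const2[OF A2]) (use B2 in blast)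
    then show "(norm (h x - (\<Sum>k<m. g k x)))\<^sup>2 \<le> 2 * (1/2) ^ m * H x"
      by (simp add: field_simps power_one_over)
  qed
  have sh: "square_integrable h"
    unfolding square_integrable_def
  proof
    show "integrable lborel (\<lambda>x. (norm (h x))\<^sup>2)"
      by (rule Bochner_Integration.integrable_bound[OF integrable_mult_right[OF iH, of 2]])
        (use bound[of 0] in \<open>auto elim!: eventually_mono intro: order_trans[OF _ abs_ge_self]\<close>)
  qed measurable
  have lim: "(\<lambda>m. norm (abs_L2 h - (\<Sum>k<m. f k))) \<longlonglongrightarrow> 0"
  proof -
    have le: "(norm (abs_L2 h - (\<Sum>k<m. f k)))\<^sup>2 \<le> 2 * (1/2) ^ m * (LINT x|lborel. H x)" for m
    proof -
      note sd = square_integrable_diff[OF sh abs_L2_sum(1)[OF g(1)]]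
      have "(norm (abs_L2 h - (\<Sum>k<m. f k)))\<^sup>2 = (LINT x|lborel. (norm (h x - (\<Sum>k<m. g k x)))\<^sup>2)"
        unfolding g(2) abs_L2_sum(2)[OF g(1)] abs_L2_diff[OF sh abs_L2_sum(1)[OF g(1)]]
        by (rule norm_abs_L2[OF sd])
      also have "\<dots> \<le> (LINT x|lborel. 2 * (1/2) ^ m * H x)"
        by (intro integral_mono_AE bound integrable_mult_right iH) (use sd in \<open>simp add: square_integrable_def\<close>)
      finally show ?thesis by simp
    qed
    have "(\<lambda>m. 2 * (1/2) ^ m * (LINT x|lborel. H x)) \<longlonglongrightarrow> 2 * 0 * (LINT x|lborel. H x)"
      by (intro tendsto_mult tendsto_const LIMSEQ_power_zero) simp
    then have "(\<lambda>m. 2 * (1/2) ^ m * (LINT x|lborel. H x)) \<longlonglongrightarrow> 0"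
      by simp
    then have "(\<lambda>m. (norm (abs_L2 h - (\<Sum>k<m. f k)))\<^sup>2) \<longlonglongrightarrow> 0"
      by (rule tendsto_sandwich[OF always_eventually always_eventually tendsto_const, rotated 2])
        (simp_all only: le zero_le_power2 simp_thms)
    then have "(\<lambda>m. sqrt ((norm (abs_L2 h - (\<Sum>k<m. f k)))\<^sup>2)) \<longlonglongrightarrow> sqrt 0"
      by (intro tendsto_intros)
    then show ?thesis by simp
  qed
  have "f sums abs_L2 h"
    unfolding sums_def
    by (subst LIM_zero_iff[symmetric], subst tendsto_norm_zero_iff[symmetric])
      (use lim in \<open>simp add: norm_minus_commute\<close>)
  then show ?thesis by (rule sums_summable)
qed

lemma scaleC_vec_of_real: "scaleC_vec (of_real r) u = r *\<^sub>R u"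
proof -
  have "scaleC_L2 (of_real r) v = r *\<^sub>R v" for v
  proof -
    obtain f where f: "square_integrable f" "v = abs_L2 f" by (rule L2_exhaust)
    show ?thesis by (simp add: f abs_L2_scaleC abs_L2_scaleR scaleR_conv_of_real del: complex_scaleR)
  qed
  then show ?thesis by (simp add: scaleC_vec_def vec_eq_iff)
qed

text \<open>Truncating the series of the eigenvector leaves an error \<open>err m\<close> in the last two coordinates only,
  so the truncations converge in the graph norm.\<close>

lemma tridiagonal_eigenvector:
  fixes G :: "nat \<Rightarrow> L2 ^ 2" and d :: "nat \<Rightarrow> real" and S :: "((L2 ^ 2) \<times> (L2 ^ 2)) set"
  assumes S: "S \<subseteq> ncho \<alpha> \<beta>" "\<And>x y. x \<in> S \<Longrightarrow> y \<in> S \<Longrightarrow> x + y \<in> S" "\<And>r x. x \<in> S \<Longrightarrow> r *\<^sub>R x \<in> S"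
    and G: "\<And>k. (G k, d k *\<^sub>R G k - (1/4) *\<^sub>R G (Suc k) - (2 * real k * (2 * real k - 1)) *\<^sub>R G (k - 1)) \<in> S"
    and norm_G: "\<And>k. norm (G k) \<le> norm (hermite_fun (2 * k))"
    and d: "\<And>k. d k \<ge> d 0 + 4 * real k"
    and G0: "gpair (hermite 0) (G 0 $ i) \<noteq> 0" "\<And>k. gpair (hermite 0) (G (Suc k) $ i) = 0"
  shows "\<exists>\<mu> \<le> d 0. eigenvalue (ncho \<alpha> \<beta>) (of_real \<mu>)"
proof -
  obtain s where s: "\<And>k. s k \<in> {0..1/2}"
    and s_eq: "\<And>k. s k * (d (Suc k) - d 0 + s 0 / 2 - (real k + 3/2) * s (Suc k)) = real (Suc k)"
    using continued_fraction_solution_exists[of "\<lambda>k. d (Suc k) - d 0"] d by (metis add.commute diff_le_eq le_diff_eq)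
  define \<mu> where "\<mu> = d 0 - s 0 / 2"
  \<comment> \<open>The coefficients of the eigenvector with respect to \<open>G\<close>, recovered
    from their ratios s k / (4 (k + 1)).\<close>
  define p where "p k = (\<Prod>j<k. s j / (4 * real (Suc j)))" for k
  have p0: "p 0 = 1" and p_Suc: "p (Suc k) = s k / (4 * real (Suc k)) * p k" for k
    by (simp_all add: p_def)
  have p_nonneg: "p k \<ge> 0" for k unfolding p_def using s by (intro prod_nonneg) auto
  have up: "(2 * real k + 2) * (2 * real k + 1) * p (Suc k) = (real k + 1/2) * s k * p k" for k
    unfolding p_Suc by (simp add: field_simps)
  \<comment> \<open>\<open>rec0\<close> holds by the choice of \<open>\<mu>\<close>,
    \<open>rec\<close> by \<open>s_eq\<close>; together they are the eigenvalue equation for the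
    formal series with coefficients \<open>p\<close>.\<close>
  have rec0: "(d 0 - \<mu>) * p 0 = 2 * 1 * p 1"
    using up[of 0] by (simp add: \<mu>_def p0)
  have rec: "(d (Suc k) - \<mu>) * p (Suc k) = (2 * real (Suc k) + 2) * (2 * real (Suc k) + 1) * p (Suc (Suc k)) + 1/4 * p k" for k
  proof -
    have "(d (Suc k) - \<mu>) * p (Suc k) - (real (Suc k) + 1/2) * s (Suc k) * p (Suc k) =
      (s k * (d (Suc k) - d 0 + s 0 / 2 - (real k + 3/2) * s (Suc k))) / (4 * real (Suc k)) * p k"
    proof -
      have e: "real k + 3/2 = real (Suc k) + 1/2" by simp
      show ?thesis
        unfolding p_Suc[of k] \<mu>_def e
        by (simp add: algebra_simps add_divide_distrib diff_divide_distrib del: of_nat_Suc)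
    qed
    also have "\<dots> = 1/4 * p k" unfolding s_eq by (simp del: of_nat_Suc)
    finally show ?thesis unfolding up[of "Suc k"] by simp
  qed
  define F where "F k = p k *\<^sub>R G k" for k
  define err where "err m = ((2 * real m + 2) * (2 * real m + 1) * p (Suc m)) *\<^sub>R G m - (1/4 * p m) *\<^sub>R G (Suc m)" for m
  have step: "((\<Sum>k<Suc m. F k), \<mu> *\<^sub>R (\<Sum>k<Suc m. F k) + err m) \<in> S" for m
  proof (induction m)
    case 0
    have "(d 0 * p 0) *\<^sub>R G 0 = \<mu> *\<^sub>R p 0 *\<^sub>R G 0 + (2 * p 1) *\<^sub>R G 0"
      using rec0 by (simp add: p0 flip: scaleR_add_left)
    \<comment> \<open>\<open>G (0 - 1)\<close> is \<open>G 0\<close>, but its coefficient is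
      0.\<close>
    then have "p 0 *\<^sub>R (G 0, d 0 *\<^sub>R G 0 - (1/4) *\<^sub>R G (Suc 0) - (2 * real 0 * (2 * real 0 - 1)) *\<^sub>R G (0 - 1)) =
        ((\<Sum>k<Suc 0. F k), \<mu> *\<^sub>R (\<Sum>k<Suc 0. F k) + err 0)"
      by (simp add: F_def err_def p0 scaleR_diff_right)
    then show ?case using S(3)[OF G[of 0], of "p 0"] by simp
  next
    case (Suc m)
    have "(d (Suc m) * p (Suc m)) *\<^sub>R G (Suc m) = \<mu> *\<^sub>R p (Suc m) *\<^sub>R G (Suc m) +
       ((2 * real (Suc m) + 2) * (2 * real (Suc m) + 1) * p (Suc (Suc m))) *\<^sub>R G (Suc m) + (1/4 * p m) *\<^sub>R G (Suc m)"
      using rec[of m] by (simp only: scaleR_scaleR scaleR_add_left[symmetric]) (simp add: algebra_simps)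
    moreover have "(2 * real (Suc m) * (2 * real (Suc m) - 1)) = (2 * real m + 2) * (2 * real m + 1)"
      by (simp add: algebra_simps)
    ultimately have "((\<Sum>k<Suc m. F k), \<mu> *\<^sub>R (\<Sum>k<Suc m. F k) + err m) +
        p (Suc m) *\<^sub>R (G (Suc m), d (Suc m) *\<^sub>R G (Suc m) - (1/4) *\<^sub>R G (Suc (Suc m))
         - (2 * real (Suc m) * (2 * real (Suc m) - 1)) *\<^sub>R G (Suc m - 1)) =
        ((\<Sum>k<Suc (Suc m). F k), \<mu> *\<^sub>R (\<Sum>k<Suc (Suc m). F k) + err (Suc m))"
      by (simp add: F_def err_def scaleR_diff_right scaleR_add_right mult.commute del: of_nat_Suc)
    then show ?case using S(2)[OF Suc.IH S(3)[OF G[of "Suc m"], of "p (Suc m)"]] by simp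
  qed
  define N where "N = norm (hermite_fun 0)"
  \<comment> \<open>The factor 4 (k + 1) by which the norms may grow cancels against the one in
    \<open>p_Suc\<close>, leaving s k \<le> 1/2.\<close>
  have q: "p k * norm (hermite_fun (2 * k)) \<le> N * (1/2) ^ k" for k
  proof (induction k)
    case (Suc k)
    have "p (Suc k) * norm (hermite_fun (2 * Suc k)) \<le> p (Suc k) * (4 * real (Suc k) * norm (hermite_fun (2 * k)))"
      using norm_hermite_fun_step[of "2 * k"] p_nonneg by (intro mult_left_mono) auto
    also have "\<dots> = s k * (p k * norm (hermite_fun (2 * k)))"
      unfolding p_Suc by simp
    also have "\<dots> \<le> 1/2 * (N * (1/2) ^ k)"
      using s[of k] p_nonneg[of k] by (intro mult_mono Suc.IH) auto
    finally show ?case by simp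
  qed (simp add: p0 N_def)
  have norm_F: "norm (F k) \<le> N * (1/2) ^ k" for k
  proof -
    have "norm (F k) \<le> p k * norm (hermite_fun (2 * k))"
      using p_nonneg[of k] norm_G[of k] by (simp add: F_def mult_left_mono)
    with q[of k] show ?thesis by linarith
  qed
  have norm_err: "norm (err m) \<le> 2 * N * (real (Suc m) * (1/2) ^ m)" for m
  proof -
    have "norm (err m) \<le> norm (((2 * real m + 2) * (2 * real m + 1) * p (Suc m)) *\<^sub>R G m) + norm ((1/4 * p m) *\<^sub>R G (Suc m))"
      unfolding err_def by (rule norm_triangle_ineq4)
    also have "\<dots> = (real m + 1/2) * s m * p m * norm (G m) + 1/4 * p m * norm (G (Suc m))"
      unfolding up norm_scaleR using s[of m] p_nonneg[of m] by (simp add: abs_mult)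
    also have "\<dots> \<le> (real m + 1/2) * 1 * p m * norm (hermite_fun (2 * m)) + 1/4 * p m * (4 * real (Suc m) * norm (hermite_fun (2 * m)))"
      using s[of m] p_nonneg[of m] norm_G[of m] norm_G[of "Suc m"] norm_hermite_fun_step[of "2 * m"]
      by (intro add_mono mult_mono mult_nonneg_nonneg) auto
    also have "\<dots> = (2 * real m + 3/2) * (p m * norm (hermite_fun (2 * m)))"
      by (simp add: algebra_simps)
    also have "\<dots> \<le> (2 * real (Suc m)) * (N * (1/2) ^ m)"
      using p_nonneg[of m] by (intro mult_mono q) auto
    finally show ?thesis by (simp add: mult_ac del: of_nat_Suc)
  qed
  have "(\<lambda>m. 2 * N * (real (Suc m) * (1/2) ^ m)) \<longlonglongrightarrow> 2 * N * 0"
    by (intro tendsto_mult_left) real_asymp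
  then have err_0: "err \<longlonglongrightarrow> 0"
    using Lim_null_comparison[OF always_eventually[OF allI[OF norm_err]]] by simp
  have "summable (\<lambda>k. F k $ j)" for j
    by (rule summable_L2_geometric[of _ N]) (rule order_trans[OF Finite_Cartesian_Product.norm_nth_le norm_F])
  then have "(\<lambda>m. \<Sum>k<m. F k $ j) \<longlonglongrightarrow> (\<Sum>k. F k $ j)" for j
    by (rule summable_LIMSEQ)
  define \<phi> :: "L2 ^ 2" where "\<phi> = (\<chi> j. \<Sum>k. F k $ j)"
  have "(\<lambda>m. \<Sum>k<m. F k) \<longlonglongrightarrow> \<phi>"
    using \<open>\<And>j. (\<lambda>m. \<Sum>k<m. F k $ j) \<longlonglongrightarrow> (\<Sum>k. F k $ j)\<close>
    by (intro vec_tendstoI) (simp add: \<phi>_def)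
  then have lim: "(\<lambda>m. \<Sum>k<Suc m. F k) \<longlonglongrightarrow> \<phi>"
    by (rule LIMSEQ_Suc)
  then have L: "(\<lambda>m. ((\<Sum>k<Suc m. F k), \<mu> *\<^sub>R (\<Sum>k<Suc m. F k) + err m)) \<longlonglongrightarrow> (\<phi>, \<mu> *\<^sub>R \<phi> + 0)"
    by (intro tendsto_intros err_0)
  have C: "closed (ncho \<alpha> \<beta>)" by (simp add: ncho_def)
  have "(\<phi>, \<mu> *\<^sub>R \<phi> + 0) \<in> ncho \<alpha> \<beta>"
    by (rule closed_sequentially[OF C _ L]) (use step S(1) in blast)
  then have "\<phi> \<in> eigenspace (ncho \<alpha> \<beta>) (of_real \<mu>)"
    by (simp add: eigenspace_def scaleC_vec_of_real)
  moreover have "\<phi> \<noteq> 0"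
  proof
    \<comment> \<open>Pairing with \<open>hermite 0\<close> sees only \<open>G 0\<close>, which has
      weight 1, and this value survives the limit.\<close>
    have "gpair (hermite 0) ((\<Sum>k<Suc m. F k) $ i) = gpair (hermite 0) (G 0 $ i)" for m
    proof (induction m)
      case 0
      show ?case by (simp add: F_def p0)
    next
      case (Suc m)
      then show ?case
        using G0(2)[of m] by (simp add: gpair_add gpair_scaleR F_def del: hermite.simps)
    qed
    then have "(\<lambda>m. gpair (hermite 0) (G 0 $ i)) \<longlonglongrightarrow> gpair (hermite 0) (\<phi> $ i)"
      using tendsto_gpair[OF tendsto_vec_nth[OF lim, of i], of "hermite 0"] by (simp only:)
    then have "gpair (hermite 0) (\<phi> $ i) = gpair (hermite 0) (G 0 $ i)"
      by (simp add: LIMSEQ_const_iff)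
    moreover assume "\<phi> = 0"
    ultimately show False using G0(1) by (simp add: gpair_0)
  qed
  ultimately have "eigenvalue (ncho \<alpha> \<beta>) (of_real \<mu>)"
    by (auto simp: eigenvalue_def)
  moreover have "\<mu> \<le> d 0" using s[of 0] by (simp add: \<mu>_def)
  ultimately show ?thesis by blast
qed

section \<open>The operator on pairs of polynomials times a Gaussian\<close>

definition gpoly_vec :: "real poly \<Rightarrow> real poly \<Rightarrow> L2 ^ 2" where
  "gpoly_vec p q = (\<chi> i. abs_L2 (gpoly (if i = 1 then p else q)))"

lemma gpoly_vec_nth: "gpoly_vec p q $ 1 = abs_L2 (gpoly p)" "gpoly_vec p q $ 2 = abs_L2 (gpoly q)"
  by (simp_all add: gpoly_vec_def)

lemma abs_L2_gpoly_add: "abs_L2 (gpoly (p + q)) = abs_L2 (gpoly p) + abs_L2 (gpoly q)"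
  by (simp add: abs_L2_add square_integrable_gpoly gpoly_add[abs_def])

lemma abs_L2_gpoly_smult: "abs_L2 (gpoly (smult r p)) = r *\<^sub>R abs_L2 (gpoly p)"
  by (simp add: abs_L2_scaleR square_integrable_gpoly gpoly_smult[abs_def] scaleR_conv_of_real)

lemma abs_L2_gpoly_diff: "abs_L2 (gpoly (p - q)) = abs_L2 (gpoly p) - abs_L2 (gpoly q)"
  by (simp add: abs_L2_diff square_integrable_gpoly gpoly_diff[abs_def])

lemma gpoly_vec_add: "gpoly_vec p q + gpoly_vec p' q' = gpoly_vec (p + p') (q + q')"
  by (simp add: gpoly_vec_def vec_eq_iff abs_L2_gpoly_add)

lemma gpoly_vec_scaleR: "r *\<^sub>R gpoly_vec p q = gpoly_vec (smult r p) (smult r q)"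
  by (simp add: gpoly_vec_def vec_eq_iff abs_L2_gpoly_smult)

lemma gpoly_vec_diff: "gpoly_vec p q - gpoly_vec p' q' = gpoly_vec (p - p') (q - q')"
  by (simp add: gpoly_vec_def vec_eq_iff abs_L2_gpoly_diff)

text \<open>A part of the graph whose linearity is plain polynomial algebra and which contains the
  truncations of the eigenvector.\<close>

definition ncho_gpoly_vec :: "real \<Rightarrow> real \<Rightarrow> ((L2 ^ 2) \<times> (L2 ^ 2)) set" where
  "ncho_gpoly_vec \<alpha> \<beta> = {(gpoly_vec p q, gpoly_vec (smult \<alpha> (osc_poly p) - dil_poly q) (smult \<beta> (osc_poly q) + dil_poly p)) | p q. True}"

lemma ncho_gpoly_vec_subset: "ncho_gpoly_vec \<alpha> \<beta> \<subseteq> ncho \<alpha> \<beta>"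
proof -
  have "(gpoly_vec p q, gpoly_vec (smult \<alpha> (osc_poly p) - dil_poly q) (smult \<beta> (osc_poly q) + dil_poly p))
      \<in> ncho_schwartz \<alpha> \<beta>" for p q
  proof -
    define f :: "(real \<Rightarrow> complex) ^ 2" where "f = (\<chi> i. gpoly (if i = 1 then p else q))"
    have "gpoly_vec p q = class_vec f"
      by (simp add: gpoly_vec_def class_vec_def f_def)
    moreover have "gpoly_vec (smult \<alpha> (osc_poly p) - dil_poly q) (smult \<beta> (osc_poly q) + dil_poly p) =
        class_vec (ncho_expr \<alpha> \<beta> f)"
    proof -
      have "ncho_expr \<alpha> \<beta> f $ 1 = gpoly (smult \<alpha> (osc_poly p) - dil_poly q)"
        "ncho_expr \<alpha> \<beta> f $ 2 = gpoly (smult \<beta> (osc_poly q) + dil_poly p)"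
        by (simp_all add: fun_eq_iff ncho_expr_1 ncho_expr_2 f_def osc_gpoly dil_gpoly gpoly_diff gpoly_add
            gpoly_smult scaleR_conv_of_real)
      then show ?thesis
        by (simp add: vec_eq_iff forall_2 gpoly_vec_nth class_vec_def)
    qed
    moreover have "\<forall>i. schwartz (f $ i)" by (simp add: f_def schwartz_gpoly)
    ultimately show ?thesis unfolding ncho_schwartz_def by blast
  qed
  then show ?thesis
    unfolding ncho_def ncho_gpoly_vec_def using closure_subset by blast
qed

lemma gder_add: "gder (p + q) = gder p + gder q" and gder_smult: "gder (smult r p) = smult r (gder p)"
  by (intro poly_ext, simp add: gder_def pderiv_add pderiv_smult algebra_simps)+

lemma osc_poly_add: "osc_poly (p + q) = osc_poly p + osc_poly q"
  and osc_poly_smult: "osc_poly (smult r p) = smult r (osc_poly p)"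
  and dil_poly_add: "dil_poly (p + q) = dil_poly p + dil_poly q"
  and dil_poly_smult: "dil_poly (smult r p) = smult r (dil_poly p)"
  by (intro poly_ext, simp add: osc_poly_def dil_poly_def gder_add gder_smult algebra_simps)+

lemma ncho_pvecI:
  assumes "u = gpoly_vec p q"
    "w = gpoly_vec (smult \<alpha> (osc_poly p) - dil_poly q) (smult \<beta> (osc_poly q) + dil_poly p)"
  shows "(u, w) \<in> ncho_gpoly_vec \<alpha> \<beta>"
  using assms by (auto simp: ncho_gpoly_vec_def)

lemma ncho_gpoly_vec_add:
  assumes "x \<in> ncho_gpoly_vec \<alpha> \<beta>" "y \<in> ncho_gpoly_vec \<alpha> \<beta>"
  shows "x + y \<in> ncho_gpoly_vec \<alpha> \<beta>"
proof -
  obtain p q p' q' where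
    "x = (gpoly_vec p q, gpoly_vec (smult \<alpha> (osc_poly p) - dil_poly q) (smult \<beta> (osc_poly q) + dil_poly p))"
    "y = (gpoly_vec p' q', gpoly_vec (smult \<alpha> (osc_poly p') - dil_poly q') (smult \<beta> (osc_poly q') + dil_poly p'))"
    using assms by (auto simp: ncho_gpoly_vec_def)
  then show ?thesis
    by (simp add: gpoly_vec_add) (intro ncho_pvecI[of _ "p + p'" "q + q'"],
        simp_all add: osc_poly_add dil_poly_add smult_add_right algebra_simps)
qed

lemma ncho_gpoly_vec_scaleR:
  assumes "x \<in> ncho_gpoly_vec \<alpha> \<beta>"
  shows "r *\<^sub>R x \<in> ncho_gpoly_vec \<alpha> \<beta>"
proof -
  obtain p q where
    "x = (gpoly_vec p q, gpoly_vec (smult \<alpha> (osc_poly p) - dil_poly q) (smult \<beta> (osc_poly q) + dil_poly p))"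
    using assms by (auto simp: ncho_gpoly_vec_def)
  then show ?thesis
    by (simp add: gpoly_vec_scaleR) (intro ncho_pvecI[of _ "smult r p" "smult r q"],
        simp_all add: osc_poly_smult dil_poly_smult smult_add_right smult_diff_right mult.commute)
qed

text \<open>With the signs \<open>+, +, -, -, \<dots>\<close> all off-diagonal entries of the even sectors become negative.\<close>

definition hermite_sign :: "nat \<Rightarrow> real" where
  "hermite_sign k = (if k mod 4 < 2 then 1 else -1)"

lemma hermite_sign_Suc: "hermite_sign (Suc k) = (if even k then hermite_sign k else - hermite_sign k)"
proof -
  have "k mod 4 = 0 \<or> k mod 4 = 1 \<or> k mod 4 = 2 \<or> k mod 4 = 3" by linarith
  moreover have "even k \<longleftrightarrow> even (k mod 4)" by presburger
  ultimately show ?thesis by (auto simp: hermite_sign_def mod_Suc)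
qed

lemma hermite_sign_abs: "\<bar>hermite_sign k\<bar> = 1" by (simp add: hermite_sign_def)

definition signed_hermite :: "nat \<Rightarrow> real poly" where
  "signed_hermite k = smult (hermite_sign k) (hermite (2 * k))"

lemma osc_signed_hermite: "osc_poly (signed_hermite k) = smult (2 * real k + 1/2) (signed_hermite k)"
  by (simp add: signed_hermite_def osc_poly_smult osc_hermite mult.commute)

text \<open>The sign pattern changes towards exactly one of the two neighbours, which offsets the
  opposite signs of lowering and raising in \<open>dil_hermite\<close>; one common sign, alternating
  with k, remains.\<close>

lemma dil_signed_hermite:
  "dil_poly (signed_hermite k) = (if even k then -1 else 1) *
     (smult (2 * real k * (2 * real k - 1)) (signed_hermite (k - 1)) + smult (1/4) (signed_hermite (Suc k)))"
proof -
  have r: "real (2 * k) * real (2 * k - 1) = 2 * real k * (2 * real k - 1)" by (cases k) auto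
  have i: "2 * k - 2 = 2 * (k - 1)" "2 * k + 2 = 2 * Suc k" by simp_all
  have s: "k > 0 \<Longrightarrow> hermite_sign k = (if even k then - 1 else 1) * hermite_sign (k - 1)"
    using hermite_sign_Suc[of "k - 1"] by (cases "even k") (auto simp: even_diff_nat)
  show ?thesis
    unfolding signed_hermite_def dil_poly_smult dil_hermite r i hermite_sign_Suc
    by (cases "k = 0"; intro poly_ext) (simp_all add: s algebra_simps del: hermite.simps)
qed

lemma norm_signed_hermite: "norm (abs_L2 (gpoly (signed_hermite k))) = norm (hermite_fun (2 * k))"
  by (simp add: signed_hermite_def abs_L2_gpoly_smult hermite_fun_def hermite_sign_abs)

lemma gpair_0_signed_hermite: "gpair (hermite 0) (abs_L2 (gpoly (signed_hermite (Suc k)))) = 0"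
  using gpair_0_hermite_fun_Suc[of "2 * k + 1"] by (simp add: signed_hermite_def abs_L2_gpoly_smult gpair_scaleR hermite_fun_def del: hermite.simps)

lemma norm_vec_2: "norm (x :: L2 ^ 2) = sqrt ((norm (x $ 1))\<^sup>2 + (norm (x $ 2))\<^sup>2)"
  by (simp add: norm_vec_def L2_set_def sum_2)

lemma abs_L2_gpoly_0: "abs_L2 (gpoly 0) = 0"
  using abs_L2_gpoly_smult[of 0 0] by simp

lemma gpoly_vec_0_0: "gpoly_vec 0 0 = 0"
  by (simp add: gpoly_vec_def vec_eq_iff abs_L2_gpoly_0)

lemma osc_poly_0: "osc_poly 0 = 0" and dil_poly_0: "dil_poly 0 = 0"
  using osc_poly_smult[of 0 0] dil_poly_smult[of 0 0] by simp_all

text \<open>The sector of the Gaussian in the first component, with diagonal entries drawn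
  alternately from \<alpha> and \<beta>. Starting at the smaller one and \<alpha> > 2 give d k \<ge>
  d 0 + 4 k.\<close>

lemma exists_eigenvalue_le_left:
  assumes "\<alpha> > 2" "\<alpha> \<le> \<beta>"
  shows "\<exists>\<mu> \<le> \<alpha> / 2. eigenvalue (ncho \<alpha> \<beta>) (of_real \<mu>)"
proof -
  define d where "d k = (if even k then \<alpha> else \<beta>) * (2 * real k + 1/2)" for k
  define G where "G k = (if even k then gpoly_vec (signed_hermite k) 0 else gpoly_vec 0 (signed_hermite k))" for k
  have "\<exists>\<mu> \<le> d 0. eigenvalue (ncho \<alpha> \<beta>) (of_real \<mu>)"
  proof (rule tridiagonal_eigenvector[OF ncho_gpoly_vec_subset ncho_gpoly_vec_add ncho_gpoly_vec_scaleR])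
    show "(G k, d k *\<^sub>R G k - (1/4) *\<^sub>R G (Suc k) - (2 * real k * (2 * real k - 1)) *\<^sub>R G (k - 1)) \<in> ncho_gpoly_vec \<alpha> \<beta>" for k
    proof (cases "even k")
      case True
      have c: "(2 * real k * (2 * real k - 1)) *\<^sub>R G (k - 1) = gpoly_vec 0 (smult (2 * real k * (2 * real k - 1)) (signed_hermite (k - 1)))"
        using True by (cases k) (simp_all add: G_def gpoly_vec_scaleR gpoly_vec_0_0 del: of_nat_Suc)
      show ?thesis
        unfolding c using True
        by (intro ncho_pvecI[of _ "signed_hermite k" 0])
          (simp_all add: G_def d_def gpoly_vec_scaleR gpoly_vec_diff osc_poly_0 dil_poly_0 osc_signed_hermite dil_signed_hermite minus_diff_commute add.commute)
    next
      case False
      have c: "(2 * real k * (2 * real k - 1)) *\<^sub>R G (k - 1) = gpoly_vec (smult (2 * real k * (2 * real k - 1)) (signed_hermite (k - 1))) 0"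
        using False by (cases k) (simp_all add: G_def gpoly_vec_scaleR del: of_nat_Suc)
      show ?thesis
        unfolding c using False
        by (intro ncho_pvecI[of _ 0 "signed_hermite k"])
          (simp_all add: G_def d_def gpoly_vec_scaleR gpoly_vec_diff osc_poly_0 dil_poly_0 osc_signed_hermite dil_signed_hermite minus_diff_commute add.commute)
    qed
    show "norm (G k) \<le> norm (hermite_fun (2 * k))" for k
      by (simp add: G_def norm_vec_2 gpoly_vec_nth norm_signed_hermite abs_L2_gpoly_0)
    show "d k \<ge> d 0 + 4 * real k" for k
    proof -
      have "\<alpha> * (2 * real k + 1/2) \<le> \<beta> * (2 * real k + 1/2)"
        using assms by (intro mult_right_mono) auto
      moreover have "4 * real k \<le> 2 * \<alpha> * real k"
        using assms by (intro mult_right_mono) auto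
      ultimately show ?thesis by (auto simp: d_def algebra_simps)
    qed
    show "gpair (hermite 0) (G 0 $ 1) \<noteq> 0"
      using gpair_0_hermite_fun_0_neq_0 by (simp add: G_def gpoly_vec_nth signed_hermite_def hermite_sign_def hermite_fun_def del: hermite.simps)
    show "gpair (hermite 0) (G (Suc k) $ 1) = 0" for k
      using gpair_0_signed_hermite by (simp add: G_def gpoly_vec_nth abs_L2_gpoly_0 gpair_0)
  qed
  then show ?thesis by (simp add: d_def)
qed

lemma exists_eigenvalue_le_right:
  assumes "\<beta> > 2" "\<beta> \<le> \<alpha>"
  shows "\<exists>\<mu> \<le> \<beta> / 2. eigenvalue (ncho \<alpha> \<beta>) (of_real \<mu>)"
proof -
  define d where "d k = (if even k then \<beta> else \<alpha>) * (2 * real k + 1/2)" for k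
  \<comment> \<open>The entries of J have opposite signs, so in this sector the odd members need an
    extra minus sign for negative off-diagonal entries.\<close>
  define G where "G k = (if even k then gpoly_vec 0 (signed_hermite k) else gpoly_vec (- signed_hermite k) 0)" for k
  have "\<exists>\<mu> \<le> d 0. eigenvalue (ncho \<alpha> \<beta>) (of_real \<mu>)"
  proof (rule tridiagonal_eigenvector[OF ncho_gpoly_vec_subset ncho_gpoly_vec_add ncho_gpoly_vec_scaleR])
    show "(G k, d k *\<^sub>R G k - (1/4) *\<^sub>R G (Suc k) - (2 * real k * (2 * real k - 1)) *\<^sub>R G (k - 1)) \<in> ncho_gpoly_vec \<alpha> \<beta>" for k
    proof (cases "even k")
      case True
      have c: "(2 * real k * (2 * real k - 1)) *\<^sub>R G (k - 1) = gpoly_vec (- smult (2 * real k * (2 * real k - 1)) (signed_hermite (k - 1))) 0"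
        using True by (cases k) (simp_all add: G_def gpoly_vec_scaleR gpoly_vec_0_0 del: of_nat_Suc)
      show ?thesis
        unfolding c using True
        by (intro ncho_pvecI[of _ 0 "signed_hermite k"])
          (simp_all add: G_def d_def gpoly_vec_scaleR gpoly_vec_diff osc_poly_0 dil_poly_0 osc_signed_hermite dil_signed_hermite minus_diff_commute add.commute)
    next
      case False
      have c: "(2 * real k * (2 * real k - 1)) *\<^sub>R G (k - 1) = gpoly_vec 0 (smult (2 * real k * (2 * real k - 1)) (signed_hermite (k - 1)))"
        using False by (cases k) (simp_all add: G_def gpoly_vec_scaleR del: of_nat_Suc)
      have m: "osc_poly (- signed_hermite k) = - osc_poly (signed_hermite k)" "dil_poly (- signed_hermite k) = - dil_poly (signed_hermite k)"
        using osc_poly_smult[of "-1" "signed_hermite k"] dil_poly_smult[of "-1" "signed_hermite k"] by simp_all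
      show ?thesis
        unfolding c using False
        by (intro ncho_pvecI[of _ "- signed_hermite k" 0])
          (simp_all add: G_def d_def gpoly_vec_scaleR gpoly_vec_diff osc_poly_0 dil_poly_0 m osc_signed_hermite dil_signed_hermite minus_diff_commute add.commute)
    qed
    show "norm (G k) \<le> norm (hermite_fun (2 * k))" for k
      using abs_L2_gpoly_smult[of "-1" "signed_hermite k"]
      by (simp add: G_def norm_vec_2 gpoly_vec_nth norm_signed_hermite abs_L2_gpoly_0)
    show "d k \<ge> d 0 + 4 * real k" for k
    proof -
      have "\<beta> * (2 * real k + 1/2) \<le> \<alpha> * (2 * real k + 1/2)"
        using assms by (intro mult_right_mono) auto
      moreover have "4 * real k \<le> 2 * \<beta> * real k"
        using assms by (intro mult_right_mono) auto
      ultimately show ?thesis by (auto simp: d_def algebra_simps)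
    qed
    show "gpair (hermite 0) (G 0 $ 2) \<noteq> 0"
      using gpair_0_hermite_fun_0_neq_0 by (simp add: G_def gpoly_vec_nth signed_hermite_def hermite_sign_def hermite_fun_def del: hermite.simps)
    show "gpair (hermite 0) (G (Suc k) $ 2) = 0" for k
      using gpair_0_signed_hermite by (simp add: G_def gpoly_vec_nth abs_L2_gpoly_0 gpair_0)
  qed
  then show ?thesis by (simp add: d_def)
qed

section \<open>Even eigenvectors\<close>

lemma poly_hermite_minus: "poly (hermite n) (- x) = (- 1) ^ n * poly (hermite n) x"
proof (induction n rule: less_induct)
  case (less n)
  show ?case
  proof (cases n)
    case (Suc m)
    show ?thesis
    proof (cases m)
      case 0
      then show ?thesis using Suc by simp
    next
      case (Suc l)
      have n: "n = Suc (Suc l)" using \<open>n = Suc m\<close> Suc by simp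
      have rec: "poly (hermite n) y = 2 * y * poly (hermite (Suc l)) y - 2 * real (Suc l) * poly (hermite l) y" for y
        unfolding n hermite.simps(2)[of "Suc l"] pderiv_hermite by simp
      have "poly (hermite (Suc l)) (- x) = (- 1) ^ Suc l * poly (hermite (Suc l)) x"
        and "poly (hermite l) (- x) = (- 1) ^ l * poly (hermite l) x"
        by (intro less.IH; simp add: n)+
      then show ?thesis
        unfolding rec by (simp add: n algebra_simps del: hermite.simps)
    qed
  qed simp
qed

text \<open>Reflection multiplies the n-th coefficient by (-1)^n. If the odd ones vanish, the
  function and its reflection have equal coefficients, and completeness identifies them.\<close>

lemma even_L2_if_odd_coeffs_0:
  assumes z: "\<And>k. gpair (hermite (2 * k + 1)) v = 0"
  shows "even_L2 v"
proof -
  obtain f where f: "square_integrable f" and v: "v = abs_L2 f" by (rule L2_exhaust)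
  have [measurable]: "f \<in> borel_measurable borel" using f by (simp add: square_integrable_def)
  define g where "g x = f (- x)" for x
  have g: "square_integrable g"
    unfolding square_integrable_def
  proof
    show "integrable lborel (\<lambda>x. (norm (g x))\<^sup>2)"
      using lborel_integrable_real_affine[of "\<lambda>x. (norm (f x))\<^sup>2" "-1" 0] f
      by (simp add: square_integrable_def g_def)
  qed (simp add: g_def[abs_def])
  have "gpair (hermite n) (abs_L2 g) = (- 1) ^ n * gpair (hermite n) v" for n
  proof -
    have "gpair (hermite n) (abs_L2 g) = (LINT x|lborel. f x * gpoly (hermite n) (- x))"
      unfolding gpair_abs_L2[OF g]
      using lborel_integral_real_affine[of "-1" "\<lambda>x. f x * gpoly (hermite n) (- x)" 0]
      by (simp add: g_def)
    also have "\<dots> = (LINT x|lborel. (- 1) ^ n * (f x * gpoly (hermite n) x))"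
      by (simp add: gpoly_def poly_hermite_minus mult_ac)
    also have "\<dots> = (- 1) ^ n * gpair (hermite n) v"
      by (simp add: v gpair_abs_L2 f)
    finally show ?thesis .
  qed
  moreover have "gpair (hermite n) v = 0" if "odd n" for n
    using that z by (auto elim!: oddE simp del: hermite.simps)
  ultimately have "gpair (hermite n) (abs_L2 g - v) = 0" for n
    by (cases "even n") (simp_all add: gpair_diff)
  then have "abs_L2 g - v = 0" by (rule hermite_complete)
  then have "abs_L2 (\<lambda>x. g x - f x) = 0"
    by (simp add: v abs_L2_diff f g)
  then have "AE x in lborel. g x - f x = 0"
    by (subst (asm) abs_L2_eq_0_iff) (intro square_integrable_diff f g)
  then have "AE x in lborel. f (- x) = f x"
    by eventually_elim (simp add: g_def)
  then show ?thesis
    by (simp add: v even_L2.abs_eq eq_onp_def L2_rel_refl f)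
qed

text \<open>Stated through coefficients alone, so that it is visibly a complex subspace; spans of
  sets of ground states therefore stay inside it.\<close>

definition even_solutions :: "real \<Rightarrow> real \<Rightarrow> real \<Rightarrow> (L2 ^ 2) set" where
  "even_solutions \<alpha> \<beta> E = {u. coef_rec \<alpha> \<beta> E u \<and> (\<forall>i. gpair (hermite 1) (u $ i) = 0)}"

lemma csubspace_even_solutions: "csubspace (even_solutions \<alpha> \<beta> E)"
  unfolding CL2.subspace_def even_solutions_def coef_rec_def
  by (simp add: gpair_0 gpair_add gpair_scaleC scaleC_vec_def ring_distribs mult.left_commute del: hermite.simps)

lemma even_solutions_odd_coeffs:
  assumes "u \<in> even_solutions \<alpha> \<beta> E"
  shows "gpair (hermite (2 * k + 1)) (u $ i) = 0"
  using coef_rec_vanish[of \<alpha> \<beta> E u 1 k] assms exhaust_2[of i]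
  by (auto simp: even_solutions_def simp del: hermite.simps)

lemma even_solutions_eq_0:
  assumes u: "u \<in> even_solutions \<alpha> \<beta> E" and z: "\<And>i. gpair (hermite 0) (u $ i) = 0"
  shows "u = 0"
proof -
  have "gpair (hermite n) (u $ i) = 0" for n i
  proof (cases "even n")
    case True
    then obtain k where "n = 2 * k" by blast
    then show ?thesis
      using coef_rec_vanish[of \<alpha> \<beta> E u 0 k] u z exhaust_2[of i]
      by (auto simp: even_solutions_def simp del: hermite.simps)
  next
    case False
    then obtain k where "n = 2 * k + 1" by (elim oddE)
    then show ?thesis using even_solutions_odd_coeffs[OF u] by simp
  qed
  then show ?thesis using hermite_complete by (auto simp: vec_eq_iff)
qed

theorem theorem1p1:
  fixes \<alpha> \<beta> E :: real
  assumes "\<alpha> > 2" and "\<beta> > 2"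
    and "lowest_eigenvalue (ncho \<alpha> \<beta>) E"
  shows "(\<exists>B. finite B \<and> eigenspace (ncho \<alpha> \<beta>) (of_real E) \<subseteq> cspan B)
    \<and> cdim (eigenspace (ncho \<alpha> \<beta>) (of_real E)) \<le> 2
    \<and> eigenspace (ncho \<alpha> \<beta>) (of_real E) \<subseteq> {u. \<forall>i. u $ i \<in> L_plus}"
proof -
  define V where "V = eigenspace (ncho \<alpha> \<beta>) (of_real E)"
  define K where "K = even_solutions \<alpha> \<beta> E"
  have "\<exists>\<mu> \<le> min \<alpha> \<beta> / 2. eigenvalue (ncho \<alpha> \<beta>) (of_real \<mu>)"
    using exists_eigenvalue_le_left[of \<alpha> \<beta>] exists_eigenvalue_le_right[of \<beta> \<alpha>] assms(1,2)
    by (cases "\<alpha> \<le> \<beta>") (auto simp: min_def)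
  then have E: "E \<le> min \<alpha> \<beta> / 2"
    using assms(3) unfolding lowest_eigenvalue_def by (meson order_trans)
  have VK: "V \<subseteq> K"
  proof
    fix u assume "u \<in> V"
    then have rec: "coef_rec \<alpha> \<beta> E u" unfolding V_def by (rule eigenspace_coef_rec)
    have "gpair (hermite 1) (u $ i) = 0" for i
      using coef_rec_odd[OF rec assms(1,2)] E exhaust_2[of i] by (auto simp: min_def split: if_splits)
    with rec show "u \<in> K" by (simp add: K_def even_solutions_def)
  qed
  \<comment> \<open>\<open>cdim V\<close> is the size of a basis taken inside \<open>V\<close>, so
    it remains to show that \<open>B\<close> is finite with at most two elements.\<close>
  obtain B where B: "B \<subseteq> V" "\<not> cdependent B" "V \<subseteq> cspan B" "card B = cdim V"
    using CL2.basis_exists by blast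
  interpret P: vector_space_pair scaleC_vec "(*s) :: complex \<Rightarrow> complex ^ 2 \<Rightarrow> complex ^ 2" ..
  \<comment> \<open>The pair of lowest coefficients, which is injective on \<open>K\<close> and
    hence on \<open>cspan B\<close>.\<close>
  define T :: "L2 ^ 2 \<Rightarrow> complex ^ 2" where "T u = (\<chi> i. gpair (hermite 0) (u $ i))" for u
  have lin: "Vector_Spaces.linear scaleC_vec (*s) T"
    unfolding Vector_Spaces.linear_iff
    by (intro conjI allI CL2.vector_space_axioms vec.vector_space_axioms)
      (simp_all add: T_def vec_eq_iff gpair_add gpair_scaleC scaleC_vec_def)
  have "cspan B \<subseteq> K"
    using B(1) VK unfolding K_def by (intro CL2.span_minimal csubspace_even_solutions) auto
  moreover have "u = 0" if "u \<in> K" "T u = 0" for u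
    using that even_solutions_eq_0[of u] unfolding K_def by (simp add: T_def vec_eq_iff)
  ultimately have inj: "inj_on T (cspan B)"
    unfolding P.linear_inj_on_iff_eq_0[OF lin CL2.subspace_span] by blast
  have "vec.independent (T ` B)"
    using P.linear_independent_injective_image[OF lin B(2) inj] .
  then have "finite (T ` B)" "card (T ` B) \<le> 2"
    using vec.finiteI_independent vec.independent_card_le_dim[of "T ` B" UNIV, unfolded vec_dim_card]
    by simp_all
  moreover have "inj_on T B" using inj CL2.span_superset by (rule inj_on_subset)
  ultimately have "finite B" "card B \<le> 2"
    using finite_imageD by (auto simp: card_image)
  moreover have "V \<subseteq> {u. \<forall>i. u $ i \<in> L_plus}"
    using VK even_solutions_odd_coeffs even_L2_if_odd_coeffs_0 by (auto simp: L_plus_def K_def)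
  ultimately show ?thesis
    using B(3,4) unfolding V_def by auto
qed

end
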